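(* Let $F,G:\mathbb A\to\mathbb B$ be pseudo double functors between strict double categories. Suppose that there is a connection on the 1v-cell components of strong vertical transformations. Then there is a bijection between strong vertical transformations $F\Rightarrow G$ and those strong horizontal transformations $F\Rightarrow G$ whose 1h-cell components are 1h-companions of some 1v-cells.
   Context: Cells of a strict double category: 0-cells, horizontal 1-cells (1h-cells), vertical 1-cells (1v-cells), squares (2-cells). A square has boundary $(t,b,l,r)$ if its top and bottom 1h-cells are $t,b$ and its left and right 1v-cells are $l,r$. $[\omega|\zeta]$ is horizontal composition ($\omega$ on the left), $\frac{\omega}{\zeta}$ vertical composition ($\omega$ on top). 1-cells compose by juxtaposition, $gf$ meaning $f$ first. $\mathrm{Id}_f$ and $\mathrm{Id}_u$ are the identity squares on a 1h-cell $f$ and a 1v-cell $u$. Pseudo double functor $F:\mathbb A\to\mathbb B$: preserves vertical composition and vertical identities strictly (for 1v-cells and squares), and horizontal composition and identities up to coherent, natural, vertically invertible globular squares $F_{gf}$ with top $F(gf)$ and bottom $F(g)F(f)$, and $F_A$ with top $F(\mathrm{id}_A)$ and bottom $\mathrm{id}_{F(A)}$. Strong horizontal transformation $\alpha_1:F\Rightarrow G$: 1h-cells $\alpha_1(A):F(A)\to G(A)$; for each 1v-cell $u:A\to A'$ a square $(\alpha_1)_u$ with boundary $(\alpha_1(A),\alpha_1(A'),F(u),G(u))$; for each 1h-cell $f:A\to B$ a square $\delta_{\alpha_1,f}$ with boundary $(\alpha_1(B)F(f),G(f)\alpha_1(A),\mathrm{id},\mathrm{id})$; such that: for each square $a$ with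 boundary $(f,g,u,v)$, $\frac{[F(a)|(\alpha_1)_v]}{\delta_{\alpha_1,g}}=\frac{\delta_{\alpha_1,f}}{[(\alpha_1)_u|G(a)]}$; $(\alpha_1)_{vu}=\frac{(\alpha_1)_u}{(\alpha_1)_v}$ and $(\alpha_1)_{\mathrm{id}_A}=\mathrm{Id}_{\alpha_1(A)}$; $\delta_{\alpha_1,gf}$ is the vertical composite, from top to bottom, of $[F_{gf}|\mathrm{Id}]$, $[\mathrm{Id}_{F(f)}|\delta_{\alpha_1,g}]$, $[\delta_{\alpha_1,f}|\mathrm{Id}_{G(g)}]$, $[\mathrm{Id}|G_{gf}^{-1}]$; and the vertical composite of $[F_A^{-1}|\mathrm{Id}]$, $\delta_{\alpha_1,\mathrm{id}_A}$, $[\mathrm{Id}|G_A]$ is $\mathrm{Id}_{\alpha_1(A)}$. Strong vertical transformation $\alpha_0:F\Rightarrow G$: 1v-cells $\alpha_0(A):F(A)\to G(A)$; for each 1h-cell $f:A\to B$ a square $(\alpha_0)_f$ with boundary $(F(f),G(f),\alpha_0(A),\alpha_0(B))$; for each 1v-cell $u:A\to A'$ a square $\delta_{\alpha_0,u}$ with identity top and bottom, left side $\alpha_0(A')F(u)$ and right side $G(u)\alpha_0(A)$; such that: for each square $a$ with boundary $(f,g,u,v)$, $[\frac{F(a)}{(\alpha_0)_g}|\delta_{\alpha_0,v}]=[\delta_{\alpha_0,u}|\frac{(\alpha_0)_f}{G(a)}]$; $\frac{F_{gf}}{[(\alpha_0)_f|(\alpha_0)_g]}=\frac{(\alpha_0)_{gf}}{G_{gf}}$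 and $\frac{F_A}{\mathrm{Id}_{\alpha_0(A)}}=\frac{(\alpha_0)_{\mathrm{id}_A}}{G_A}$; $\delta_{\alpha_0,vu}=[\frac{\mathrm{Id}_{F(u)}}{\delta_{\alpha_0,v}}|\frac{\delta_{\alpha_0,u}}{\mathrm{Id}_{G(v)}}]$ and $\delta_{\alpha_0,\mathrm{id}_A}=\mathrm{Id}_{\alpha_0(A)}$. A companion (1h-companion) of a 1v-cell $u:A\to A'$ is a 1h-cell $u_*:A\to A'$ with squares $\eta$ of boundary $(\mathrm{id}_A,u_*,\mathrm{id},u)$ and $\varepsilon$ of boundary $(u_*,\mathrm{id}_{A'},u,\mathrm{id})$ such that $[\eta|\varepsilon]=\mathrm{Id}_{u_*}$ and $\frac{\eta}{\varepsilon}=\mathrm{Id}_u$. A connection on a class of 1v-cells is a functorial choice of a companion for each 1v-cell in the class.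
   Formalization: The horizontal transformations are taken together with the 1v-cells of which their components are companions, and the companions are those chosen by the connection; for the bare set of horizontal transformations the bijection fails (e.g. one 1v-cell with two companions). *)

theory Defs
  imports "HOL-Library.FuncSet"
begin

section \<open>Strict double categories\<close>

text \<open>
  Cells are carried by sets, so the empty double category is allowed. All composites of 1-cells
  are written in applicative order (\<open>g \<cdot> f\<close> and \<open>v \<bullet> u\<close> mean: first the right-hand factor), whereas
  pasting of squares is written in diagrammatic order: \<open>a \<parallel> b\<close> is the horizontal composite
  $[a|b]$ with \<open>a\<close> on the left and \<open>a \<oslash> b\<close> is the vertical composite $\frac{a}{b}$ with \<open>a\<close> on top.
\<close>

record ('o, 'h, 'v, 's) double_category =
  Obj :: "'o set"
  Hor :: "'h set"
  Ver :: "'v set"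
  Sqr :: "'s set"
  hdom :: "'h \<Rightarrow> 'o"
  hcod :: "'h \<Rightarrow> 'o"
  vdom :: "'v \<Rightarrow> 'o"
  vcod :: "'v \<Rightarrow> 'o"
  stop :: "'s \<Rightarrow> 'h"
  sbot :: "'s \<Rightarrow> 'h"
  sleft :: "'s \<Rightarrow> 'v"
  sright :: "'s \<Rightarrow> 'v"
  hid :: "'o \<Rightarrow> 'h"
  vid :: "'o \<Rightarrow> 'v"
  hcomp :: "'h \<Rightarrow> 'h \<Rightarrow> 'h"  (infixl "\<cdot>\<index>" 75)
  vcomp :: "'v \<Rightarrow> 'v \<Rightarrow> 'v"  (infixl "\<bullet>\<index>" 75)
  IdH :: "'h \<Rightarrow> 's"
  IdV :: "'v \<Rightarrow> 's"
  hpaste :: "'s \<Rightarrow> 's \<Rightarrow> 's"  (infixl "\<parallel>\<index>" 70)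
  vpaste :: "'s \<Rightarrow> 's \<Rightarrow> 's"  (infixl "\<oslash>\<index>" 65)

definition hcell :: "('o, 'h, 'v, 's) double_category \<Rightarrow> 'h \<Rightarrow> 'o \<Rightarrow> 'o \<Rightarrow> bool" where
  "hcell D f X Y \<longleftrightarrow> f \<in> Hor D \<and> hdom D f = X \<and> hcod D f = Y"

definition vcell :: "('o, 'h, 'v, 's) double_category \<Rightarrow> 'v \<Rightarrow> 'o \<Rightarrow> 'o \<Rightarrow> bool" where
  "vcell D u X Y \<longleftrightarrow> u \<in> Ver D \<and> vdom D u = X \<and> vcod D u = Y"

text \<open>Boundaries are listed in the order top, bottom, left, right.\<close>

definition square ::
  "('o, 'h, 'v, 's) double_category \<Rightarrow> 's \<Rightarrow> 'h \<Rightarrow> 'h \<Rightarrow> 'v \<Rightarrow> 'v \<Rightarrow> bool" where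
  "square D a t b l r \<longleftrightarrow>
     a \<in> Sqr D \<and> stop D a = t \<and> sbot D a = b \<and> sleft D a = l \<and> sright D a = r"

text \<open>
  Besides the category axioms in both directions, the last four axioms say that horizontal
  composition and horizontal identities of squares are functorial in the vertical direction.
\<close>

locale strict_double_category =
  fixes D :: "('o, 'h, 'v, 's) double_category" (structure)
  assumes hcell_ends: "f \<in> Hor D \<Longrightarrow> hdom D f \<in> Obj D \<and> hcod D f \<in> Obj D"
    and hid_hcell: "X \<in> Obj D \<Longrightarrow> hcell D (hid D X) X X"
    and hcomp_hcell: "\<lbrakk>hcell D f X Y; hcell D g Y Z\<rbrakk> \<Longrightarrow> hcell D (g \<cdot> f) X Z"
    and hcomp_id_right: "hcell D f X Y \<Longrightarrow> f \<cdot> hid D X = f"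
    and hcomp_id_left: "hcell D f X Y \<Longrightarrow> hid D Y \<cdot> f = f"
    and hcomp_assoc:
      "\<lbrakk>hcell D f W X; hcell D g X Y; hcell D h Y Z\<rbrakk> \<Longrightarrow> (h \<cdot> g) \<cdot> f = h \<cdot> (g \<cdot> f)"
    and vcell_ends: "u \<in> Ver D \<Longrightarrow> vdom D u \<in> Obj D \<and> vcod D u \<in> Obj D"
    and vid_vcell: "X \<in> Obj D \<Longrightarrow> vcell D (vid D X) X X"
    and vcomp_vcell: "\<lbrakk>vcell D u X Y; vcell D v Y Z\<rbrakk> \<Longrightarrow> vcell D (v \<bullet> u) X Z"
    and vcomp_id_right: "vcell D u X Y \<Longrightarrow> u \<bullet> vid D X = u"
    and vcomp_id_left: "vcell D u X Y \<Longrightarrow> vid D Y \<bullet> u = u"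
    and vcomp_assoc:
      "\<lbrakk>vcell D u W X; vcell D v X Y; vcell D w Y Z\<rbrakk> \<Longrightarrow> (w \<bullet> v) \<bullet> u = w \<bullet> (v \<bullet> u)"
    and square_edges:
      "a \<in> Sqr D \<Longrightarrow>
         stop D a \<in> Hor D \<and> sbot D a \<in> Hor D \<and> sleft D a \<in> Ver D \<and> sright D a \<in> Ver D"
    and square_corners:
      "a \<in> Sqr D \<Longrightarrow>
         vdom D (sleft D a) = hdom D (stop D a) \<and> vdom D (sright D a) = hcod D (stop D a) \<and>
         vcod D (sleft D a) = hdom D (sbot D a) \<and> vcod D (sright D a) = hcod D (sbot D a)"
    and IdV_square: "vcell D u X Y \<Longrightarrow> square D (IdV D u) (hid D X) (hid D Y) u u"
    and hpaste_square:
      "\<lbrakk>square D a t b l k; square D a' t' b' k r\<rbrakk> \<Longrightarrow> square D (a \<parallel> a') (t' \<cdot> t) (b' \<cdot> b) l r"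
    and hpaste_id_left: "square D a t b l r \<Longrightarrow> IdV D l \<parallel> a = a"
    and hpaste_id_right: "square D a t b l r \<Longrightarrow> a \<parallel> IdV D r = a"
    and hpaste_assoc:
      "\<lbrakk>square D a t b l k; square D a' t' b' k k'; square D a'' t'' b'' k' r\<rbrakk>
         \<Longrightarrow> (a \<parallel> a') \<parallel> a'' = a \<parallel> (a' \<parallel> a'')"
    and IdH_square: "hcell D f X Y \<Longrightarrow> square D (IdH D f) f f (vid D X) (vid D Y)"
    and vpaste_square:
      "\<lbrakk>square D a t m l r; square D a' m b l' r'\<rbrakk> \<Longrightarrow> square D (a \<oslash> a') t b (l' \<bullet> l) (r' \<bullet> r)"
    and vpaste_id_top: "square D a t b l r \<Longrightarrow> IdH D t \<oslash> a = a"
    and vpaste_id_bot: "square D a t b l r \<Longrightarrow> a \<oslash> IdH D b = a"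
    and vpaste_assoc:
      "\<lbrakk>square D a t m l r; square D a' m n l' r'; square D a'' n b l'' r''\<rbrakk>
         \<Longrightarrow> (a \<oslash> a') \<oslash> a'' = a \<oslash> (a' \<oslash> a'')"
    and interchange:
      "\<lbrakk>square D a t m l k; square D a' t' m' k r; square D c m n l' k'; square D c' m' n' k' r'\<rbrakk>
         \<Longrightarrow> (a \<parallel> a') \<oslash> (c \<parallel> c') = (a \<oslash> c) \<parallel> (a' \<oslash> c')"
    and IdH_hcomp: "\<lbrakk>hcell D f X Y; hcell D g Y Z\<rbrakk> \<Longrightarrow> IdH D (g \<cdot> f) = IdH D f \<parallel> IdH D g"
    and IdV_vcomp: "\<lbrakk>vcell D u X Y; vcell D v Y Z\<rbrakk> \<Longrightarrow> IdV D (v \<bullet> u) = IdV D u \<oslash> IdV D v"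
    and IdH_hid: "X \<in> Obj D \<Longrightarrow> IdH D (hid D X) = IdV D (vid D X)"

definition vinverse_of :: "('o, 'h, 'v, 's) double_category \<Rightarrow> 's \<Rightarrow> 's \<Rightarrow> bool" where
  "vinverse_of D a a' \<longleftrightarrow>
     a \<in> Sqr D \<and> a' \<in> Sqr D \<and> stop D a' = sbot D a \<and> sbot D a' = stop D a \<and>
     a \<oslash>\<^bsub>D\<^esub> a' = IdH D (stop D a) \<and> a' \<oslash>\<^bsub>D\<^esub> a = IdH D (sbot D a)"

definition vinvertible :: "('o, 'h, 'v, 's) double_category \<Rightarrow> 's \<Rightarrow> bool" where
  "vinvertible D a \<longleftrightarrow> (\<exists>a'. vinverse_of D a a')"

definition vinv :: "('o, 'h, 'v, 's) double_category \<Rightarrow> 's \<Rightarrow> 's" where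
  "vinv D a = (THE a'. vinverse_of D a a')"

section \<open>Pseudo double functors\<close>

record ('o, 'h, 'v, 's, 'p, 'i, 'w, 't) double_functor =
  Fobj :: "'o \<Rightarrow> 'p"
  Fhor :: "'h \<Rightarrow> 'i"
  Fver :: "'v \<Rightarrow> 'w"
  Fsqr :: "'s \<Rightarrow> 't"
  Fcomp :: "'h \<Rightarrow> 'h \<Rightarrow> 't"
  Funit :: "'o \<Rightarrow> 't"

text \<open>\<open>Fcomp F g f\<close> is the comparison square $F_{gf}$ and \<open>Funit F X\<close> is $F_X$.\<close>

locale pseudo_double_functor =
  A: strict_double_category A + B: strict_double_category B
  for A :: "('o, 'h, 'v, 's) double_category"
    and B :: "('p, 'i, 'w, 't) double_category" +
  fixes F :: "('o, 'h, 'v, 's, 'p, 'i, 'w, 't) double_functor"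
  assumes Fobj: "X \<in> Obj A \<Longrightarrow> Fobj F X \<in> Obj B"
    and Fhor: "hcell A f X Y \<Longrightarrow> hcell B (Fhor F f) (Fobj F X) (Fobj F Y)"
    and Fver: "vcell A u X Y \<Longrightarrow> vcell B (Fver F u) (Fobj F X) (Fobj F Y)"
    and Fsqr: "square A a f g u v \<Longrightarrow>
      square B (Fsqr F a) (Fhor F f) (Fhor F g) (Fver F u) (Fver F v)"
    and Fver_vid: "X \<in> Obj A \<Longrightarrow> Fver F (vid A X) = vid B (Fobj F X)"
    and Fver_vcomp: "\<lbrakk>vcell A u X Y; vcell A v Y Z\<rbrakk>
      \<Longrightarrow> Fver F (v \<bullet>\<^bsub>A\<^esub> u) = Fver F v \<bullet>\<^bsub>B\<^esub> Fver F u"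
    and Fsqr_IdH: "hcell A f X Y \<Longrightarrow> Fsqr F (IdH A f) = IdH B (Fhor F f)"
    and Fsqr_vpaste: "\<lbrakk>square A a t m l r; square A a' m b l' r'\<rbrakk>
      \<Longrightarrow> Fsqr F (a \<oslash>\<^bsub>A\<^esub> a') = Fsqr F a \<oslash>\<^bsub>B\<^esub> Fsqr F a'"
    and Fcomp_square: "\<lbrakk>hcell A f X Y; hcell A g Y Z\<rbrakk> \<Longrightarrow>
      square B (Fcomp F g f) (Fhor F (g \<cdot>\<^bsub>A\<^esub> f)) (Fhor F g \<cdot>\<^bsub>B\<^esub> Fhor F f)
        (vid B (Fobj F X)) (vid B (Fobj F Z))"
    and Fcomp_vinvertible: "\<lbrakk>hcell A f X Y; hcell A g Y Z\<rbrakk> \<Longrightarrow> vinvertible B (Fcomp F g f)"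
    and Funit_square: "X \<in> Obj A \<Longrightarrow>
      square B (Funit F X) (Fhor F (hid A X)) (hid B (Fobj F X))
        (vid B (Fobj F X)) (vid B (Fobj F X))"
    and Funit_vinvertible: "X \<in> Obj A \<Longrightarrow> vinvertible B (Funit F X)"
    and Fcomp_natural: "\<lbrakk>square A a f f' u v; square A a' g g' v w\<rbrakk> \<Longrightarrow>
      Fsqr F (a \<parallel>\<^bsub>A\<^esub> a') \<oslash>\<^bsub>B\<^esub> Fcomp F g' f' = Fcomp F g f \<oslash>\<^bsub>B\<^esub> (Fsqr F a \<parallel>\<^bsub>B\<^esub> Fsqr F a')"
    and Funit_natural: "vcell A u X Y \<Longrightarrow>
      Fsqr F (IdV A u) \<oslash>\<^bsub>B\<^esub> Funit F Y = Funit F X \<oslash>\<^bsub>B\<^esub> IdV B (Fver F u)"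
    and Fcomp_assoc: "\<lbrakk>hcell A f W X; hcell A g X Y; hcell A h Y Z\<rbrakk> \<Longrightarrow>
      Fcomp F h (g \<cdot>\<^bsub>A\<^esub> f) \<oslash>\<^bsub>B\<^esub> (Fcomp F g f \<parallel>\<^bsub>B\<^esub> IdH B (Fhor F h)) =
      Fcomp F (h \<cdot>\<^bsub>A\<^esub> g) f \<oslash>\<^bsub>B\<^esub> (IdH B (Fhor F f) \<parallel>\<^bsub>B\<^esub> Fcomp F h g)"
    and Fcomp_unit_right: "hcell A f X Y \<Longrightarrow>
      Fcomp F f (hid A X) \<oslash>\<^bsub>B\<^esub> (Funit F X \<parallel>\<^bsub>B\<^esub> IdH B (Fhor F f)) = IdH B (Fhor F f)"
    and Fcomp_unit_left: "hcell A f X Y \<Longrightarrow>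
      Fcomp F (hid A Y) f \<oslash>\<^bsub>B\<^esub> (IdH B (Fhor F f) \<parallel>\<^bsub>B\<^esub> Funit F Y) = IdH B (Fhor F f)"

section \<open>Strong transformations\<close>

text \<open>
  The components are functions on the cells of \<open>A\<close>; they are required to be extensional, so that
  two transformations with the same components are equal.
\<close>

record ('o, 'h, 'v, 'i, 't) horizontal_data =
  ht_obj :: "'o \<Rightarrow> 'i"
  ht_ver :: "'v \<Rightarrow> 't"
  ht_delta :: "'h \<Rightarrow> 't"

locale strong_horizontal_transformation =
  F: pseudo_double_functor A B F + G: pseudo_double_functor A B G
  for A :: "('o, 'h, 'v, 's) double_category"
    and B :: "('p, 'i, 'w, 't) double_category"
    and F G :: "('o, 'h, 'v, 's, 'p, 'i, 'w, 't) double_functor" +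
  fixes \<alpha> :: "('o, 'h, 'v, 'i, 't) horizontal_data"
  assumes ext: "ht_obj \<alpha> \<in> extensional (Obj A)" "ht_ver \<alpha> \<in> extensional (Ver A)"
      "ht_delta \<alpha> \<in> extensional (Hor A)"
    and obj_hcell: "X \<in> Obj A \<Longrightarrow> hcell B (ht_obj \<alpha> X) (Fobj F X) (Fobj G X)"
    and ver_square: "vcell A u X Y \<Longrightarrow>
      square B (ht_ver \<alpha> u) (ht_obj \<alpha> X) (ht_obj \<alpha> Y) (Fver F u) (Fver G u)"
    and delta_square: "hcell A f X Y \<Longrightarrow>
      square B (ht_delta \<alpha> f) (ht_obj \<alpha> Y \<cdot>\<^bsub>B\<^esub> Fhor F f) (Fhor G f \<cdot>\<^bsub>B\<^esub> ht_obj \<alpha> X)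
        (vid B (Fobj F X)) (vid B (Fobj G Y))"
    and natural: "square A a f g u v \<Longrightarrow>
      (Fsqr F a \<parallel>\<^bsub>B\<^esub> ht_ver \<alpha> v) \<oslash>\<^bsub>B\<^esub> ht_delta \<alpha> g = ht_delta \<alpha> f \<oslash>\<^bsub>B\<^esub> (ht_ver \<alpha> u \<parallel>\<^bsub>B\<^esub> Fsqr G a)"
    and ver_vcomp: "\<lbrakk>vcell A u X Y; vcell A v Y Z\<rbrakk> \<Longrightarrow>
      ht_ver \<alpha> (v \<bullet>\<^bsub>A\<^esub> u) = ht_ver \<alpha> u \<oslash>\<^bsub>B\<^esub> ht_ver \<alpha> v"
    and ver_vid: "X \<in> Obj A \<Longrightarrow> ht_ver \<alpha> (vid A X) = IdH B (ht_obj \<alpha> X)"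
    and delta_hcomp: "\<lbrakk>hcell A f X Y; hcell A g Y Z\<rbrakk> \<Longrightarrow>
      ht_delta \<alpha> (g \<cdot>\<^bsub>A\<^esub> f) =
        (Fcomp F g f \<parallel>\<^bsub>B\<^esub> IdH B (ht_obj \<alpha> Z))
        \<oslash>\<^bsub>B\<^esub> (IdH B (Fhor F f) \<parallel>\<^bsub>B\<^esub> ht_delta \<alpha> g)
        \<oslash>\<^bsub>B\<^esub> (ht_delta \<alpha> f \<parallel>\<^bsub>B\<^esub> IdH B (Fhor G g))
        \<oslash>\<^bsub>B\<^esub> (IdH B (ht_obj \<alpha> X) \<parallel>\<^bsub>B\<^esub> vinv B (Fcomp G g f))"
    and delta_hid: "X \<in> Obj A \<Longrightarrow>
      (vinv B (Funit F X) \<parallel>\<^bsub>B\<^esub> IdH B (ht_obj \<alpha> X))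
        \<oslash>\<^bsub>B\<^esub> ht_delta \<alpha> (hid A X)
        \<oslash>\<^bsub>B\<^esub> (IdH B (ht_obj \<alpha> X) \<parallel>\<^bsub>B\<^esub> Funit G X)
      = IdH B (ht_obj \<alpha> X)"

record ('o, 'h, 'v, 'w, 't) vertical_data =
  vt_obj :: "'o \<Rightarrow> 'w"
  vt_hor :: "'h \<Rightarrow> 't"
  vt_delta :: "'v \<Rightarrow> 't"

locale strong_vertical_transformation =
  F: pseudo_double_functor A B F + G: pseudo_double_functor A B G
  for A :: "('o, 'h, 'v, 's) double_category"
    and B :: "('p, 'i, 'w, 't) double_category"
    and F G :: "('o, 'h, 'v, 's, 'p, 'i, 'w, 't) double_functor" +
  fixes \<alpha> :: "('o, 'h, 'v, 'w, 't) vertical_data"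
  assumes ext: "vt_obj \<alpha> \<in> extensional (Obj A)" "vt_hor \<alpha> \<in> extensional (Hor A)"
      "vt_delta \<alpha> \<in> extensional (Ver A)"
    and obj_vcell: "X \<in> Obj A \<Longrightarrow> vcell B (vt_obj \<alpha> X) (Fobj F X) (Fobj G X)"
    and hor_square: "hcell A f X Y \<Longrightarrow>
      square B (vt_hor \<alpha> f) (Fhor F f) (Fhor G f) (vt_obj \<alpha> X) (vt_obj \<alpha> Y)"
    and delta_square: "vcell A u X Y \<Longrightarrow>
      square B (vt_delta \<alpha> u) (hid B (Fobj F X)) (hid B (Fobj G Y))
        (vt_obj \<alpha> Y \<bullet>\<^bsub>B\<^esub> Fver F u) (Fver G u \<bullet>\<^bsub>B\<^esub> vt_obj \<alpha> X)"
    and natural: "square A a f g u v \<Longrightarrow>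
      (Fsqr F a \<oslash>\<^bsub>B\<^esub> vt_hor \<alpha> g) \<parallel>\<^bsub>B\<^esub> vt_delta \<alpha> v = vt_delta \<alpha> u \<parallel>\<^bsub>B\<^esub> (vt_hor \<alpha> f \<oslash>\<^bsub>B\<^esub> Fsqr G a)"
    and hor_hcomp: "\<lbrakk>hcell A f X Y; hcell A g Y Z\<rbrakk> \<Longrightarrow>
      Fcomp F g f \<oslash>\<^bsub>B\<^esub> (vt_hor \<alpha> f \<parallel>\<^bsub>B\<^esub> vt_hor \<alpha> g) = vt_hor \<alpha> (g \<cdot>\<^bsub>A\<^esub> f) \<oslash>\<^bsub>B\<^esub> Fcomp G g f"
    and hor_hid: "X \<in> Obj A \<Longrightarrow>
      Funit F X \<oslash>\<^bsub>B\<^esub> IdV B (vt_obj \<alpha> X) = vt_hor \<alpha> (hid A X) \<oslash>\<^bsub>B\<^esub> Funit G X"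
    and delta_vcomp: "\<lbrakk>vcell A u X Y; vcell A v Y Z\<rbrakk> \<Longrightarrow>
      vt_delta \<alpha> (v \<bullet>\<^bsub>A\<^esub> u) =
        (IdV B (Fver F u) \<oslash>\<^bsub>B\<^esub> vt_delta \<alpha> v) \<parallel>\<^bsub>B\<^esub> (vt_delta \<alpha> u \<oslash>\<^bsub>B\<^esub> IdV B (Fver G v))"
    and delta_vid: "X \<in> Obj A \<Longrightarrow> vt_delta \<alpha> (vid A X) = IdV B (vt_obj \<alpha> X)"

definition vertical_components ::
  "('o, 'h, 'v, 's) double_category \<Rightarrow> ('p, 'i, 'w, 't) double_category \<Rightarrow>
   ('o, 'h, 'v, 's, 'p, 'i, 'w, 't) double_functor \<Rightarrow>
   ('o, 'h, 'v, 's, 'p, 'i, 'w, 't) double_functor \<Rightarrow> 'w set" where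
  "vertical_components A B F G =
     {vt_obj \<alpha> X | \<alpha> X. strong_vertical_transformation A B F G \<alpha> \<and> X \<in> Obj A}"

section \<open>Companions and connections\<close>

record ('h, 's) companion_data =
  c_hor :: 'h
  c_eta :: 's
  c_eps :: 's

definition is_companion ::
  "('o, 'h, 'v, 's) double_category \<Rightarrow> 'v \<Rightarrow> ('h, 's) companion_data \<Rightarrow> bool" where
  "is_companion D u c \<longleftrightarrow>
     u \<in> Ver D \<and>
     hcell D (c_hor c) (vdom D u) (vcod D u) \<and>
     square D (c_eta c) (hid D (vdom D u)) (c_hor c) (vid D (vdom D u)) u \<and>
     square D (c_eps c) (c_hor c) (hid D (vcod D u)) u (vid D (vcod D u)) \<and>
     c_eta c \<parallel>\<^bsub>D\<^esub> c_eps c = IdH D (c_hor c) \<and>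
     c_eta c \<oslash>\<^bsub>D\<^esub> c_eps c = IdV D u"

definition companion_id ::
  "('o, 'h, 'v, 's) double_category \<Rightarrow> 'o \<Rightarrow> ('h, 's) companion_data" where
  "companion_id D X =
     \<lparr>c_hor = hid D X, c_eta = IdH D (hid D X), c_eps = IdH D (hid D X)\<rparr>"

text \<open>
  The composite of companions \<open>c\<close> of \<open>u : X \<rightarrow> Y\<close> and \<open>d\<close> of \<open>v : Y \<rightarrow> Z\<close> is the usual companion
  structure on \<open>c_hor d \<cdot> c_hor c\<close> for \<open>v \<bullet> u\<close>.
\<close>

definition companion_comp ::
  "('o, 'h, 'v, 's) double_category \<Rightarrow> 'v \<Rightarrow> 'v \<Rightarrow>
   ('h, 's) companion_data \<Rightarrow> ('h, 's) companion_data \<Rightarrow> ('h, 's) companion_data" where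
  "companion_comp D v u d c =
     \<lparr>c_hor = c_hor d \<cdot>\<^bsub>D\<^esub> c_hor c,
      c_eta = (c_eta c \<parallel>\<^bsub>D\<^esub> IdV D u) \<oslash>\<^bsub>D\<^esub> (IdH D (c_hor c) \<parallel>\<^bsub>D\<^esub> c_eta d),
      c_eps = (c_eps c \<parallel>\<^bsub>D\<^esub> IdH D (c_hor d)) \<oslash>\<^bsub>D\<^esub> (IdV D v \<parallel>\<^bsub>D\<^esub> c_eps d)\<rparr>"

text \<open>
  The class \<open>C\<close> need not be closed under composition or contain identities; functoriality of the
  choice is demanded for all identities and composites that lie in \<open>C\<close>.
\<close>

definition connection_on ::
  "('o, 'h, 'v, 's) double_category \<Rightarrow> 'v set \<Rightarrow> ('v \<Rightarrow> ('h, 's) companion_data) \<Rightarrow> bool" where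
  "connection_on D C \<Gamma> \<longleftrightarrow>
     (\<forall>u\<in>C. is_companion D u (\<Gamma> u)) \<and>
     (\<forall>X\<in>Obj D. vid D X \<in> C \<longrightarrow> \<Gamma> (vid D X) = companion_id D X) \<and>
     (\<forall>u\<in>C. \<forall>v\<in>C. vcod D u = vdom D v \<longrightarrow> v \<bullet>\<^bsub>D\<^esub> u \<in> C \<longrightarrow>
        \<Gamma> (v \<bullet>\<^bsub>D\<^esub> u) = companion_comp D v u (\<Gamma> v) (\<Gamma> u))"

text \<open>
  Being a companion is structure: neither does a 1h-cell determine the 1v-cell of which it is a
  companion, nor a 1v-cell its companion. A strong horizontal transformation whose components are
  companions of some 1v-cells is therefore taken together with these 1v-cells \<open>u X\<close>, and the 1h-cell
  \<open>ht_obj \<beta> X\<close> is a companion of \<open>u X\<close> by way of the choice \<open>\<Gamma>\<close>. The 1v-cells \<open>u X\<close> are not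
  assumed to be components of a strong vertical transformation.
\<close>

definition companion_horizontal_transformations ::
  "('o, 'h, 'v, 's) double_category \<Rightarrow> ('p, 'i, 'w, 't) double_category \<Rightarrow>
   ('o, 'h, 'v, 's, 'p, 'i, 'w, 't) double_functor \<Rightarrow>
   ('o, 'h, 'v, 's, 'p, 'i, 'w, 't) double_functor \<Rightarrow>
   ('w \<Rightarrow> ('i, 't) companion_data) \<Rightarrow>
   (('o, 'h, 'v, 'i, 't) horizontal_data \<times> ('o \<Rightarrow> 'w)) set" where
  "companion_horizontal_transformations A B F G \<Gamma> =
     {(\<beta>, u). strong_horizontal_transformation A B F G \<beta> \<and> u \<in> extensional (Obj A) \<and>
        (\<forall>X\<in>Obj A. vcell B (u X) (Fobj F X) (Fobj G X) \<and>
           is_companion B (u X) (\<Gamma> (u X)) \<and> ht_obj \<beta> X = c_hor (\<Gamma> (u X)))}"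

end

theory Submission
  imports Defs
begin

text \<open>
  Fix 1v-cells \<open>u X : F X \<rightarrow> G X\<close> with companions \<open>c X\<close>. Pasting the squares \<open>\<eta>\<close> and \<open>\<epsilon>\<close> of the
  companions onto the sides of a square trades a companion in its horizontal boundary for the
  1v-cell itself in its vertical boundary. The two zigzag equations of a companion say that the two
  trades are mutually inverse, so squares with boundary
  \<open>(w\<^sub>* \<cdot> t, b \<cdot> u\<^sub>*, l, r)\<close> and squares with boundary \<open>(t, b, u \<bullet> l, r \<bullet> w)\<close> are in bijection; call
  corresponding squares mates.

  Both kinds of cell data of a transformation are instances of this one bijection. With \<open>l\<close> and \<open>r\<close>
  identities it matches \<open>\<delta>\<close> at a 1h-cell of a horizontal transformation with the square that a
  vertical transformation assigns to that 1h-cell; with \<open>t\<close> and \<open>b\<close> identities it does the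
  same for 1v-cells. It also covers the two sides of the naturality axioms.

  It remains to see that the axioms correspond. Since passing to mates is injective, it suffices to
  compute the mates of the composites that occur in the axioms for horizontal transformations
  (\<open>unmate_paste_above\<close>, \<open>unmate_paste_below\<close>, \<open>unmate_hcomp\<close>, \<open>unmate_globular\<close>,
  \<open>unmate_IdH\<close>), and up to moving the invertible comparison squares across an equation they are
  the composites in the axioms for vertical ones. Wherever two mates are pasted next to each other, an
  \<open>\<eta>\<close> meets an \<open>\<epsilon>\<close> of the same companion, and a zigzag equation removes the pair.

  So every axiom holds for given horizontal data exactly if the corresponding axiom holds for the
  mated vertical data (\<open>strong_transformation_iff\<close>), and passing to mates componentwise is the
  desired bijection. The 1v-cells \<open>u X\<close> are the object components on the vertical side and are
  recorded alongside the transformation on the horizontal side.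
\<close>

section \<open>Computing boundaries of pastings\<close>

text \<open>The ends of \<open>u\<close> are named so that it can be matched with the corners of other cells.\<close>

definition companion ::
  "('o, 'h, 'v, 's) double_category \<Rightarrow> ('h, 's) companion_data \<Rightarrow> 'v \<Rightarrow> 'o \<Rightarrow> 'o \<Rightarrow> bool" where
  "companion D c u X X' \<longleftrightarrow> vcell D u X X' \<and> is_companion D u c"

context strict_double_category
begin

text \<open>
  The axioms of a double category are phrased with predicates that mention intermediate objects and
  edges. The following equational forms have side conditions that are equations between boundaries,
  so the simplifier can check composability and compute boundaries of whole pastings. Composites
  are normalised to the left.
\<close>

lemma hor_simps:
  "X \<in> Obj D \<Longrightarrow> hid D X \<in> Hor D"
  "X \<in> Obj D \<Longrightarrow> hdom D (hid D X) = X"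
  "X \<in> Obj D \<Longrightarrow> hcod D (hid D X) = X"
  "\<lbrakk>f \<in> Hor D; g \<in> Hor D; hcod D f = hdom D g\<rbrakk> \<Longrightarrow> g \<cdot> f \<in> Hor D"
  "\<lbrakk>f \<in> Hor D; g \<in> Hor D; hcod D f = hdom D g\<rbrakk> \<Longrightarrow> hdom D (g \<cdot> f) = hdom D f"
  "\<lbrakk>f \<in> Hor D; g \<in> Hor D; hcod D f = hdom D g\<rbrakk> \<Longrightarrow> hcod D (g \<cdot> f) = hcod D g"
  "\<lbrakk>f \<in> Hor D; hdom D f = X\<rbrakk> \<Longrightarrow> f \<cdot> hid D X = f"
  "\<lbrakk>f \<in> Hor D; hcod D f = X\<rbrakk> \<Longrightarrow> hid D X \<cdot> f = f"
  "\<lbrakk>f \<in> Hor D; g \<in> Hor D; h \<in> Hor D; hcod D f = hdom D g; hcod D g = hdom D h\<rbrakk>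
    \<Longrightarrow> h \<cdot> (g \<cdot> f) = (h \<cdot> g) \<cdot> f"
  using hid_hcell hcomp_hcell hcomp_id_right hcomp_id_left hcomp_assoc
  by (auto simp: hcell_def)

lemma ver_simps:
  "X \<in> Obj D \<Longrightarrow> vid D X \<in> Ver D"
  "X \<in> Obj D \<Longrightarrow> vdom D (vid D X) = X"
  "X \<in> Obj D \<Longrightarrow> vcod D (vid D X) = X"
  "\<lbrakk>u \<in> Ver D; v \<in> Ver D; vcod D u = vdom D v\<rbrakk> \<Longrightarrow> v \<bullet> u \<in> Ver D"
  "\<lbrakk>u \<in> Ver D; v \<in> Ver D; vcod D u = vdom D v\<rbrakk> \<Longrightarrow> vdom D (v \<bullet> u) = vdom D u"
  "\<lbrakk>u \<in> Ver D; v \<in> Ver D; vcod D u = vdom D v\<rbrakk> \<Longrightarrow> vcod D (v \<bullet> u) = vcod D v"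
  "\<lbrakk>u \<in> Ver D; vdom D u = X\<rbrakk> \<Longrightarrow> u \<bullet> vid D X = u"
  "\<lbrakk>u \<in> Ver D; vcod D u = X\<rbrakk> \<Longrightarrow> vid D X \<bullet> u = u"
  "\<lbrakk>u \<in> Ver D; v \<in> Ver D; w \<in> Ver D; vcod D u = vdom D v; vcod D v = vdom D w\<rbrakk>
    \<Longrightarrow> w \<bullet> (v \<bullet> u) = (w \<bullet> v) \<bullet> u"
  using vid_vcell vcomp_vcell vcomp_id_right vcomp_id_left vcomp_assoc
  by (auto simp: vcell_def)

lemma id_simps:
  "u \<in> Ver D \<Longrightarrow> IdV D u \<in> Sqr D"
  "u \<in> Ver D \<Longrightarrow> stop D (IdV D u) = hid D (vdom D u)"
  "u \<in> Ver D \<Longrightarrow> sbot D (IdV D u) = hid D (vcod D u)"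
  "u \<in> Ver D \<Longrightarrow> sleft D (IdV D u) = u"
  "u \<in> Ver D \<Longrightarrow> sright D (IdV D u) = u"
  "f \<in> Hor D \<Longrightarrow> IdH D f \<in> Sqr D"
  "f \<in> Hor D \<Longrightarrow> stop D (IdH D f) = f"
  "f \<in> Hor D \<Longrightarrow> sbot D (IdH D f) = f"
  "f \<in> Hor D \<Longrightarrow> sleft D (IdH D f) = vid D (hdom D f)"
  "f \<in> Hor D \<Longrightarrow> sright D (IdH D f) = vid D (hcod D f)"
  using IdV_square IdH_square by (simp_all add: vcell_def hcell_def square_def)

lemma paste_simps:
  "\<lbrakk>a \<in> Sqr D; b \<in> Sqr D; sright D a = sleft D b\<rbrakk> \<Longrightarrow> a \<parallel> b \<in> Sqr D"
  "\<lbrakk>a \<in> Sqr D; b \<in> Sqr D; sright D a = sleft D b\<rbrakk> \<Longrightarrow> stop D (a \<parallel> b) = stop D b \<cdot> stop D a"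
  "\<lbrakk>a \<in> Sqr D; b \<in> Sqr D; sright D a = sleft D b\<rbrakk> \<Longrightarrow> sbot D (a \<parallel> b) = sbot D b \<cdot> sbot D a"
  "\<lbrakk>a \<in> Sqr D; b \<in> Sqr D; sright D a = sleft D b\<rbrakk> \<Longrightarrow> sleft D (a \<parallel> b) = sleft D a"
  "\<lbrakk>a \<in> Sqr D; b \<in> Sqr D; sright D a = sleft D b\<rbrakk> \<Longrightarrow> sright D (a \<parallel> b) = sright D b"
  "\<lbrakk>a \<in> Sqr D; b \<in> Sqr D; sbot D a = stop D b\<rbrakk> \<Longrightarrow> a \<oslash> b \<in> Sqr D"
  "\<lbrakk>a \<in> Sqr D; b \<in> Sqr D; sbot D a = stop D b\<rbrakk> \<Longrightarrow> stop D (a \<oslash> b) = stop D a"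
  "\<lbrakk>a \<in> Sqr D; b \<in> Sqr D; sbot D a = stop D b\<rbrakk> \<Longrightarrow> sbot D (a \<oslash> b) = sbot D b"
  "\<lbrakk>a \<in> Sqr D; b \<in> Sqr D; sbot D a = stop D b\<rbrakk> \<Longrightarrow> sleft D (a \<oslash> b) = sleft D b \<bullet> sleft D a"
  "\<lbrakk>a \<in> Sqr D; b \<in> Sqr D; sbot D a = stop D b\<rbrakk> \<Longrightarrow> sright D (a \<oslash> b) = sright D b \<bullet> sright D a"
  using hpaste_square vpaste_square by (simp_all add: square_def)

lemma paste_id_simps:
  "\<lbrakk>a \<in> Sqr D; sleft D a = l\<rbrakk> \<Longrightarrow> IdV D l \<parallel> a = a"
  "\<lbrakk>a \<in> Sqr D; sright D a = r\<rbrakk> \<Longrightarrow> a \<parallel> IdV D r = a"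
  "\<lbrakk>a \<in> Sqr D; X \<in> Obj D; sleft D a = vid D X\<rbrakk> \<Longrightarrow> IdH D (hid D X) \<parallel> a = a"
  "\<lbrakk>a \<in> Sqr D; X \<in> Obj D; sright D a = vid D X\<rbrakk> \<Longrightarrow> a \<parallel> IdH D (hid D X) = a"
  "\<lbrakk>a \<in> Sqr D; stop D a = t\<rbrakk> \<Longrightarrow> IdH D t \<oslash> a = a"
  "\<lbrakk>a \<in> Sqr D; sbot D a = b\<rbrakk> \<Longrightarrow> a \<oslash> IdH D b = a"
  "\<lbrakk>a \<in> Sqr D; X \<in> Obj D; stop D a = hid D X\<rbrakk> \<Longrightarrow> IdV D (vid D X) \<oslash> a = a"
  "\<lbrakk>a \<in> Sqr D; X \<in> Obj D; sbot D a = hid D X\<rbrakk> \<Longrightarrow> a \<oslash> IdV D (vid D X) = a"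
  using hpaste_id_left hpaste_id_right vpaste_id_top vpaste_id_bot IdH_hid
  by (auto simp: square_def) metis+

lemma hpaste_assoc_left:
  "\<lbrakk>a \<in> Sqr D; b \<in> Sqr D; c \<in> Sqr D; sright D a = sleft D b; sright D b = sleft D c\<rbrakk>
     \<Longrightarrow> a \<parallel> (b \<parallel> c) = (a \<parallel> b) \<parallel> c"
  by (rule hpaste_assoc[symmetric]) (auto simp: square_def)

lemma vpaste_assoc_left:
  "\<lbrakk>a \<in> Sqr D; b \<in> Sqr D; c \<in> Sqr D; sbot D a = stop D b; sbot D b = stop D c\<rbrakk>
     \<Longrightarrow> a \<oslash> (b \<oslash> c) = (a \<oslash> b) \<oslash> c"
  by (rule vpaste_assoc[symmetric]) (auto simp: square_def)

lemma columns_to_rows: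
  "\<lbrakk>a \<in> Sqr D; b \<in> Sqr D; c \<in> Sqr D; d \<in> Sqr D;
    sright D a = sleft D b; sright D c = sleft D d; sbot D a = stop D c; sbot D b = stop D d\<rbrakk>
     \<Longrightarrow> (a \<oslash> c) \<parallel> (b \<oslash> d) = (a \<parallel> b) \<oslash> (c \<parallel> d)"
  by (rule interchange[symmetric]) (auto simp: square_def)

lemmas boundary_simps = hor_simps ver_simps id_simps paste_simps paste_id_simps

lemma hcell_iff:
  "hcell D f X Y \<longleftrightarrow> f \<in> Hor D \<and> hdom D f = X \<and> hcod D f = Y \<and> X \<in> Obj D \<and> Y \<in> Obj D"
  using hcell_ends by (auto simp: hcell_def)

lemma vcell_iff:
  "vcell D u X Y \<longleftrightarrow> u \<in> Ver D \<and> vdom D u = X \<and> vcod D u = Y \<and> X \<in> Obj D \<and> Y \<in> Obj D"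
  using vcell_ends by (auto simp: vcell_def)

lemma companion_iff:
  "companion D c u X X' \<longleftrightarrow>
    (u \<in> Ver D \<and> vdom D u = X \<and> vcod D u = X' \<and> X \<in> Obj D \<and> X' \<in> Obj D) \<and>
    (c_hor c \<in> Hor D \<and> hdom D (c_hor c) = X \<and> hcod D (c_hor c) = X') \<and>
    (c_eta c \<in> Sqr D \<and> stop D (c_eta c) = hid D X \<and> sbot D (c_eta c) = c_hor c \<and>
      sleft D (c_eta c) = vid D X \<and> sright D (c_eta c) = u) \<and>
    (c_eps c \<in> Sqr D \<and> stop D (c_eps c) = c_hor c \<and> sbot D (c_eps c) = hid D X' \<and>
      sleft D (c_eps c) = u \<and> sright D (c_eps c) = vid D X') \<and>
    c_eta c \<parallel> c_eps c = IdH D (c_hor c) \<and> c_eta c \<oslash> c_eps c = IdV D u"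
  unfolding companion_def is_companion_def square_def hcell_iff vcell_iff by auto

lemmas cell_iffs = hcell_iff vcell_iff companion_iff square_def

lemma square_cells:
  assumes "square D a f g v w"
  obtains X Y X' Y' where "hcell D f X Y" "hcell D g X' Y'" "vcell D v X X'" "vcell D w Y Y'"
  using assms square_edges[of a] square_corners[of a] by (auto simp: square_def hcell_def vcell_def)

text \<open>
  In a pasting normalised to the left, \<open>\<eta>\<close> and \<open>\<epsilon>\<close> can meet without forming a subterm; these are the
  zigzag equations for that situation.
\<close>

lemma zigzag:
  assumes "companion D c u X X'"
  shows zigzag_hor:
      "\<lbrakk>a \<in> Sqr D; sright D a = vid D X\<rbrakk> \<Longrightarrow> a \<parallel> c_eta c \<parallel> c_eps c = a \<parallel> IdH D (c_hor c)"
    and zigzag_ver: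
      "\<lbrakk>a \<in> Sqr D; sbot D a = hid D X\<rbrakk> \<Longrightarrow> a \<oslash> c_eta c \<oslash> c_eps c = a \<oslash> IdV D u"
  by (simp_all add: assms[unfolded cell_iffs] flip: hpaste_assoc_left vpaste_assoc_left)

end

section \<open>Mates of squares along companions\<close>

text \<open>
  The companion \<open>cu\<close> belongs to the 1v-cell that ends the left side and \<open>cw\<close> to the one that begins
  the right side. Accordingly \<open>c_hor cu\<close> sits at the bottom and \<open>c_hor cw\<close> at the top of a mate.
\<close>

definition mate ::
  "('o, 'h, 'v, 's) double_category \<Rightarrow> ('h, 's) companion_data \<Rightarrow> ('h, 's) companion_data \<Rightarrow>
   'v \<Rightarrow> 'v \<Rightarrow> 's \<Rightarrow> 's" where
  "mate D cu cw l r a =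
     (IdV D l \<oslash>\<^bsub>D\<^esub> c_eta cu) \<parallel>\<^bsub>D\<^esub> a \<parallel>\<^bsub>D\<^esub> (c_eps cw \<oslash>\<^bsub>D\<^esub> IdV D r)"

definition unmate ::
  "('o, 'h, 'v, 's) double_category \<Rightarrow> ('h, 's) companion_data \<Rightarrow> ('h, 's) companion_data \<Rightarrow>
   'h \<Rightarrow> 'h \<Rightarrow> 's \<Rightarrow> 's" where
  "unmate D cu cw t b x =
     (IdH D t \<parallel>\<^bsub>D\<^esub> c_eta cw) \<oslash>\<^bsub>D\<^esub> x \<oslash>\<^bsub>D\<^esub> (c_eps cu \<parallel>\<^bsub>D\<^esub> IdH D b)"

context strict_double_category
begin

context
  fixes cu cw u w t b l r X X' Y Y' S T
  assumes cu: "companion D cu u X X'" and cw: "companion D cw w Y Y'"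
    and t: "hcell D t S Y" and b: "hcell D b X' T" and l: "vcell D l S X" and r: "vcell D r Y' T"
begin

private lemmas cells =
  boundary_simps cu[unfolded cell_iffs] cw[unfolded cell_iffs]
  t[unfolded cell_iffs] b[unfolded cell_iffs] l[unfolded cell_iffs] r[unfolded cell_iffs]

lemma unmate_square:
  assumes "square D x (c_hor cw \<cdot> t) (b \<cdot> c_hor cu) l r"
  shows "square D (unmate D cu cw t b x) t b (u \<bullet> l) (r \<bullet> w)"
  using assms unfolding unmate_def square_def by (simp add: cells)

lemma mate_square:
  assumes "square D a t b (u \<bullet> l) (r \<bullet> w)"
  shows "square D (mate D cu cw l r a) (c_hor cw \<cdot> t) (b \<cdot> c_hor cu) l r"
  using assms unfolding mate_def square_def by (simp add: cells)

text \<open>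
  Subdivide the pasting into three rows and three columns. The top row contains \<open>\<eta>\<close> followed by \<open>\<epsilon>\<close>
  of \<open>cw\<close> and the bottom row the same pair for \<open>cu\<close>, so both rows are identities.
\<close>

lemma mate_unmate:
  assumes x: "square D x (c_hor cw \<cdot> t) (b \<cdot> c_hor cu) l r"
  shows "mate D cu cw l r (unmate D cu cw t b x) = x"
proof -
  note [simp] = cells x[unfolded cell_iffs]
  have "mate D cu cw l r (unmate D cu cw t b x) =
      (IdH D (hid D S) \<oslash> IdV D l \<oslash> c_eta cu) \<parallel> unmate D cu cw t b x \<parallel>
      (c_eps cw \<oslash> IdV D r \<oslash> IdH D (hid D T))"
    unfolding mate_def unmate_def by simp
  also have "\<dots> = ((IdH D (hid D S) \<parallel> (IdH D t \<parallel> c_eta cw)) \<oslash> (IdV D l \<parallel> x) \<oslash>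
        (c_eta cu \<parallel> (c_eps cu \<parallel> IdH D b))) \<parallel>
      (c_eps cw \<oslash> IdV D r \<oslash> IdH D (hid D T))"
    unfolding unmate_def by (simp add: columns_to_rows del: paste_id_simps)
  also have "\<dots> = (IdH D (hid D S) \<parallel> (IdH D t \<parallel> c_eta cw) \<parallel> c_eps cw) \<oslash> (IdV D l \<parallel> x \<parallel> IdV D r) \<oslash>
      (c_eta cu \<parallel> (c_eps cu \<parallel> IdH D b) \<parallel> IdH D (hid D T))"
    by (simp add: columns_to_rows del: paste_id_simps)
  also have "\<dots> = (IdH D t \<parallel> IdH D (c_hor cw)) \<oslash> x \<oslash> (IdH D (c_hor cu) \<parallel> IdH D b)"
    by (simp add: hpaste_assoc_left zigzag_hor[OF cw])
  also have "\<dots> = IdH D (c_hor cw \<cdot> t) \<oslash> x \<oslash> IdH D (b \<cdot> c_hor cu)"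
    by (simp add: IdH_hcomp[where Y=Y] IdH_hcomp[where Y=X'] hcell_def)
  also have "\<dots> = x"
    by simp
  finally show ?thesis .
qed

text \<open>The same subdivision; now the left and the right column are identities.\<close>

lemma unmate_mate:
  assumes a: "square D a t b (u \<bullet> l) (r \<bullet> w)"
  shows "unmate D cu cw t b (mate D cu cw l r a) = a"
proof -
  note [simp] = cells a[unfolded cell_iffs]
  have "unmate D cu cw t b (mate D cu cw l r a) =
      (IdH D (hid D S) \<parallel> IdH D t \<parallel> c_eta cw) \<oslash> mate D cu cw l r a \<oslash>
      (c_eps cu \<parallel> IdH D b \<parallel> IdH D (hid D T))"
    unfolding mate_def unmate_def by simp
  also have "\<dots> = (IdH D (hid D S) \<oslash> (IdV D l \<oslash> c_eta cu) \<oslash> c_eps cu) \<parallel> (IdH D t \<oslash> a \<oslash> IdH D b) \<parallel>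
      (c_eta cw \<oslash> (c_eps cw \<oslash> IdV D r) \<oslash> IdH D (hid D T))"
    unfolding mate_def by (simp add: columns_to_rows del: paste_id_simps)
  also have "\<dots> = (IdV D l \<oslash> IdV D u) \<parallel> a \<parallel> (IdV D w \<oslash> IdV D r)"
    by (simp add: vpaste_assoc_left zigzag_ver[OF cu])
  also have "\<dots> = IdV D (u \<bullet> l) \<parallel> a \<parallel> IdV D (r \<bullet> w)"
    by (simp add: IdV_vcomp[where Y=X] IdV_vcomp[where Y=Y'] vcell_def)
  also have "\<dots> = a"
    by simp
  finally show ?thesis .
qed

lemma unmate_eq_iff:
  assumes "square D x (c_hor cw \<cdot> t) (b \<cdot> c_hor cu) l r"
    and "square D x' (c_hor cw \<cdot> t) (b \<cdot> c_hor cu) l r"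
  shows "unmate D cu cw t b x = unmate D cu cw t b x' \<longleftrightarrow> x = x'"
  by (metis assms mate_unmate)

end

section \<open>Mates of composite squares\<close>

text \<open>
  The mates of \<open>y\<close> and \<open>d\<close> contain, respectively, \<open>\<epsilon>\<close> and \<open>\<eta>\<close> of the companion \<open>cw'\<close> along which
  \<open>y\<close> and \<open>d\<close> are pasted. On the right-hand side these two squares come to lie in a common row and
  cancel. The side \<open>r'\<close> is an identity where this serves naturality; it is a proper 1v-cell where
  the lemma serves the composition of 1v-cells.
\<close>

lemma unmate_paste_above:
  assumes cu: "companion D cu u X X'" and cw: "companion D cw w Y Y'"
    and cw': "companion D cw' w' Z Z'"
    and t: "hcell D t S Y" and m: "hcell D m S' Z" and b: "hcell D b X' T"
    and l: "vcell D l S S'" and k: "vcell D k Y Z" and r: "vcell D r Y' Z'"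
    and l': "vcell D l' S' X" and r': "vcell D r' Z' T"
    and p: "square D p t m l k" and y: "square D y (c_hor cw) (c_hor cw') k r"
    and d: "square D d (c_hor cw' \<cdot> m) (b \<cdot> c_hor cu) l' r'"
  shows "unmate D cu cw t b ((p \<parallel> y) \<oslash> d) =
    (p \<oslash> unmate D cu cw' m b d) \<parallel> (unmate D cw' cw (hid D Y) (hid D Z') y \<oslash> IdV D r')"
proof -
  note [simp] = boundary_simps cu[unfolded cell_iffs] cw[unfolded cell_iffs] cw'[unfolded cell_iffs]
    t[unfolded cell_iffs] m[unfolded cell_iffs] b[unfolded cell_iffs] l[unfolded cell_iffs]
    k[unfolded cell_iffs] r[unfolded cell_iffs] l'[unfolded cell_iffs] r'[unfolded cell_iffs]
    p[unfolded cell_iffs] y[unfolded cell_iffs] d[unfolded cell_iffs]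
  have "(p \<oslash> unmate D cu cw' m b d) \<parallel> (unmate D cw' cw (hid D Y) (hid D Z') y \<oslash> IdV D r') =
      (IdH D t \<oslash> p \<oslash> (IdH D m \<parallel> c_eta cw') \<oslash> d \<oslash> (c_eps cu \<parallel> IdH D b)) \<parallel>
      (c_eta cw \<oslash> y \<oslash> c_eps cw' \<oslash> IdV D r' \<oslash> IdH D (hid D T))"
    unfolding unmate_def by (simp add: vpaste_assoc_left)
  also have "\<dots> = (IdH D t \<parallel> c_eta cw) \<oslash> (p \<parallel> y) \<oslash> (IdH D m \<parallel> c_eta cw' \<parallel> c_eps cw') \<oslash>
      (d \<parallel> IdV D r') \<oslash> (c_eps cu \<parallel> IdH D b \<parallel> IdH D (hid D T))"
    by (simp add: columns_to_rows del: paste_id_simps)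
  also have "\<dots> = (IdH D t \<parallel> c_eta cw) \<oslash> (p \<parallel> y) \<oslash> IdH D (c_hor cw' \<cdot> m) \<oslash> d \<oslash>
      (c_eps cu \<parallel> IdH D b)"
    by (simp add: zigzag_hor[OF cw'] IdH_hcomp[where Y=Z] hcell_def)
  also have "\<dots> = unmate D cu cw t b ((p \<parallel> y) \<oslash> d)"
    unfolding unmate_def by (simp add: vpaste_assoc_left)
  finally show ?thesis ..
qed

text \<open>The counterpart for the other side of the naturality axiom; here \<open>cu\<close> cancels.\<close>

lemma unmate_paste_below:
  assumes cu: "companion D cu u X X'" and cw: "companion D cw w Y Y'"
    and cu': "companion D cu' u' Z Z'"
    and t: "hcell D t X Y" and m: "hcell D m X' Y'" and b: "hcell D b Z' T"
    and l: "vcell D l X Z" and k: "vcell D k X' Z'" and r: "vcell D r Y' T"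
    and d: "square D d (c_hor cw \<cdot> t) (m \<cdot> c_hor cu) (vid D X) (vid D Y')"
    and y: "square D y (c_hor cu) (c_hor cu') l k" and q: "square D q m b k r"
  shows "unmate D cu' cw t b (d \<oslash> (y \<parallel> q)) =
    unmate D cu' cu (hid D X) (hid D Z') y \<parallel> (unmate D cu cw t m d \<oslash> q)"
proof -
  note [simp] = boundary_simps cu[unfolded cell_iffs] cw[unfolded cell_iffs] cu'[unfolded cell_iffs]
    t[unfolded cell_iffs] m[unfolded cell_iffs] b[unfolded cell_iffs] l[unfolded cell_iffs]
    k[unfolded cell_iffs] r[unfolded cell_iffs]
    d[unfolded cell_iffs] y[unfolded cell_iffs] q[unfolded cell_iffs]
  have "unmate D cu' cu (hid D X) (hid D Z') y \<parallel> (unmate D cu cw t m d \<oslash> q) =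
      (IdH D (hid D X) \<oslash> IdV D (vid D X) \<oslash> c_eta cu \<oslash> y \<oslash> c_eps cu') \<parallel>
      ((IdH D t \<parallel> c_eta cw) \<oslash> d \<oslash> (c_eps cu \<parallel> IdH D m) \<oslash> q \<oslash> IdH D b)"
    unfolding unmate_def by (simp add: vpaste_assoc_left)
  also have "\<dots> = (IdH D (hid D X) \<parallel> (IdH D t \<parallel> c_eta cw)) \<oslash> (IdV D (vid D X) \<parallel> d) \<oslash>
      (c_eta cu \<parallel> (c_eps cu \<parallel> IdH D m)) \<oslash> (y \<parallel> q) \<oslash> (c_eps cu' \<parallel> IdH D b)"
    by (simp add: columns_to_rows del: paste_id_simps)
  also have "\<dots> = (IdH D t \<parallel> c_eta cw) \<oslash> d \<oslash> IdH D (m \<cdot> c_hor cu) \<oslash> (y \<parallel> q) \<oslash>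
      (c_eps cu' \<parallel> IdH D b)"
    by (simp add: hpaste_assoc_left IdH_hcomp[where Y=X'] hcell_def)
  also have "\<dots> = unmate D cu' cw t b (d \<oslash> (y \<parallel> q))"
    unfolding unmate_def by (simp add: vpaste_assoc_left)
  finally show ?thesis ..
qed

text \<open>
  The left column is shifted two rows down against the right one, so that \<open>\<eta>\<close> of \<open>cw\<close> on the left
  meets \<open>\<epsilon>\<close> of \<open>cw\<close> on the right. This shift is why \<open>d'\<close>, although on the right, stands above \<open>d\<close>.
\<close>

lemma unmate_hcomp:
  assumes cu: "companion D cu u X X'" and cw: "companion D cw w Y Y'"
    and cx: "companion D cx x Z Z'"
    and t: "hcell D t X Y" and t': "hcell D t' Y Z" and b: "hcell D b X' Y'"
    and b': "hcell D b' Y' Z'"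
    and d: "square D d (c_hor cw \<cdot> t) (b \<cdot> c_hor cu) (vid D X) (vid D Y')"
    and d': "square D d' (c_hor cx \<cdot> t') (b' \<cdot> c_hor cw) (vid D Y) (vid D Z')"
  shows "unmate D cu cx (t' \<cdot> t) (b' \<cdot> b) ((IdH D t \<parallel> d') \<oslash> (d \<parallel> IdH D b')) =
    unmate D cu cw t b d \<parallel> unmate D cw cx t' b' d'"
proof -
  note [simp] = boundary_simps cu[unfolded cell_iffs] cw[unfolded cell_iffs] cx[unfolded cell_iffs]
    t[unfolded cell_iffs] t'[unfolded cell_iffs] b[unfolded cell_iffs] b'[unfolded cell_iffs]
    d[unfolded cell_iffs] d'[unfolded cell_iffs]
  have "unmate D cu cw t b d \<parallel> unmate D cw cx t' b' d' =
      (IdH D t \<oslash> IdH D t \<oslash> (IdH D t \<parallel> c_eta cw) \<oslash> d \<oslash> (c_eps cu \<parallel> IdH D b)) \<parallel>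
      ((IdH D t' \<parallel> c_eta cx) \<oslash> d' \<oslash> (c_eps cw \<parallel> IdH D b') \<oslash> IdH D b' \<oslash> IdH D b')"
    unfolding unmate_def by (simp add: vpaste_assoc_left)
  also have "\<dots> = (IdH D t \<parallel> (IdH D t' \<parallel> c_eta cx)) \<oslash> (IdH D t \<parallel> d') \<oslash>
      (IdH D t \<parallel> c_eta cw \<parallel> (c_eps cw \<parallel> IdH D b')) \<oslash>
      (d \<parallel> IdH D b') \<oslash> (c_eps cu \<parallel> IdH D b \<parallel> IdH D b')"
    by (simp add: columns_to_rows del: paste_id_simps)
  also have "\<dots> = (IdH D (t' \<cdot> t) \<parallel> c_eta cx) \<oslash> (IdH D t \<parallel> d') \<oslash> IdH D (b' \<cdot> (c_hor cw \<cdot> t)) \<oslash>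
      (d \<parallel> IdH D b') \<oslash> (c_eps cu \<parallel> IdH D (b' \<cdot> b))"
    by (simp add: hpaste_assoc_left IdH_hcomp[where Y=Y] IdH_hcomp[where Y=Y'] hcell_def
        zigzag_hor[OF cw])
  also have "\<dots> = unmate D cu cx (t' \<cdot> t) (b' \<cdot> b) ((IdH D t \<parallel> d') \<oslash> (d \<parallel> IdH D b'))"
    unfolding unmate_def by (simp add: vpaste_assoc_left)
  finally show ?thesis ..
qed

text \<open>
  The comparison squares of the functors are globular; by interchange they slide past \<open>\<eta>\<close> and \<open>\<epsilon>\<close>.
\<close>

lemma unmate_globular:
  assumes cu: "companion D cu u X X'" and cw: "companion D cw w Y Y'"
    and t: "hcell D t X Y" and t': "hcell D t' X Y"
    and b: "hcell D b X' Y'" and b': "hcell D b' X' Y'"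
    and p: "square D p t' t (vid D X) (vid D Y)" and q: "square D q b b' (vid D X') (vid D Y')"
    and d: "square D d (c_hor cw \<cdot> t) (b \<cdot> c_hor cu) (vid D X) (vid D Y')"
  shows "unmate D cu cw t' b' ((p \<parallel> IdH D (c_hor cw)) \<oslash> d \<oslash> (IdH D (c_hor cu) \<parallel> q)) =
    p \<oslash> unmate D cu cw t b d \<oslash> q"
proof -
  note [simp] = boundary_simps cu[unfolded cell_iffs] cw[unfolded cell_iffs]
    t[unfolded cell_iffs] t'[unfolded cell_iffs] b[unfolded cell_iffs] b'[unfolded cell_iffs]
    p[unfolded cell_iffs] q[unfolded cell_iffs] d[unfolded cell_iffs]
  have top: "(IdH D t' \<parallel> c_eta cw) \<oslash> (p \<parallel> IdH D (c_hor cw)) = p \<oslash> (IdH D t \<parallel> c_eta cw)"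
    using columns_to_rows[of p "IdH D (hid D Y)" "IdH D t" "c_eta cw"]
    by (simp flip: columns_to_rows)
  have bot: "(IdH D (c_hor cu) \<parallel> q) \<oslash> (c_eps cu \<parallel> IdH D b') = (c_eps cu \<parallel> IdH D b) \<oslash> q"
    using columns_to_rows[of "c_eps cu" "IdH D b" "IdH D (hid D X')" q]
    by (simp flip: columns_to_rows)
  have "unmate D cu cw t' b' ((p \<parallel> IdH D (c_hor cw)) \<oslash> d \<oslash> (IdH D (c_hor cu) \<parallel> q)) =
      ((IdH D t' \<parallel> c_eta cw) \<oslash> (p \<parallel> IdH D (c_hor cw))) \<oslash> d \<oslash>
      ((IdH D (c_hor cu) \<parallel> q) \<oslash> (c_eps cu \<parallel> IdH D b'))"
    unfolding unmate_def by (simp add: vpaste_assoc_left)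
  also have "\<dots> = (p \<oslash> (IdH D t \<parallel> c_eta cw)) \<oslash> d \<oslash> ((c_eps cu \<parallel> IdH D b) \<oslash> q)"
    unfolding top bot ..
  also have "\<dots> = p \<oslash> unmate D cu cw t b d \<oslash> q"
    unfolding unmate_def by (simp add: vpaste_assoc_left)
  finally show ?thesis .
qed

lemma unmate_IdH:
  assumes "companion D c u X X'"
  shows "unmate D c c (hid D X) (hid D X') (IdH D (c_hor c)) = IdV D u"
  unfolding unmate_def by (simp add: boundary_simps assms[unfolded cell_iffs])

section \<open>Vertical inverses of globular squares\<close>

context
  fixes a t b X Y
  assumes inv: "vinvertible D a" and t: "hcell D t X Y" and b: "hcell D b X Y"
    and a: "square D a t b (vid D X) (vid D Y)"
begin

private lemmas globular_cells = boundary_simps t[unfolded cell_iffs] b[unfolded cell_iffs]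
  a[unfolded cell_iffs]

lemma vinverse_of_vinv: "vinverse_of D a (vinv D a)"
proof -
  obtain a' where a': "vinverse_of D a a'"
    using inv unfolding vinvertible_def by blast
  show ?thesis
    unfolding vinv_def
  proof (rule theI[of "vinverse_of D a" a', OF a'])
    fix a'' assume a'': "vinverse_of D a a''"
    have "a'' = (a' \<oslash> a) \<oslash> a''"
      using a' a'' by (simp add: vinverse_of_def globular_cells)
    also have "\<dots> = a' \<oslash> (a \<oslash> a'')"
      using a' a'' by (intro vpaste_assoc_left[symmetric]) (simp_all add: vinverse_of_def globular_cells)
    also have "\<dots> = a'"
      using a' a'' by (simp add: vinverse_of_def globular_cells)
    finally show "a'' = a'" .
  qed
qed

text \<open>
  An inverse is only required to have the right top and bottom; that its sides are identities
  follows by comparing the sides of \<open>a \<oslash> vinv a = Id\<close>.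
\<close>

lemma vinv_square: "square D (vinv D a) b t (vid D X) (vid D Y)"
proof -
  let ?i = "vinv D a"
  have i: "?i \<in> Sqr D" "stop D ?i = b" "sbot D ?i = t" "a \<oslash> ?i = IdH D t"
    using vinverse_of_vinv by (auto simp: vinverse_of_def globular_cells)
  have "sleft D ?i \<in> Ver D" "sright D ?i \<in> Ver D" "vdom D (sleft D ?i) = X" "vdom D (sright D ?i) = Y"
    using square_edges[OF i(1)] square_corners[OF i(1)] by (auto simp: i globular_cells)
  then have "sleft D ?i = sleft D (a \<oslash> ?i)" "sright D ?i = sright D (a \<oslash> ?i)"
    by (simp_all add: i(1-3) globular_cells)
  then show ?thesis
    using i by (simp add: square_def globular_cells)
qed

lemma vpaste_left_eq_iff:
  assumes x: "square D x b n l r" and y: "square D y t n l r"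
  shows "a \<oslash> x = y \<longleftrightarrow> x = vinv D a \<oslash> y"
proof -
  have i: "a \<oslash> vinv D a = IdH D t" "vinv D a \<oslash> a = IdH D b"
    using vinverse_of_vinv by (auto simp: vinverse_of_def globular_cells)
  have "vinv D a \<oslash> (a \<oslash> x) = x" "a \<oslash> (vinv D a \<oslash> y) = y"
    using x y vinv_square by (simp_all add: square_def globular_cells vpaste_assoc_left i)
  then show ?thesis by auto
qed

lemma vpaste_right_eq_iff:
  assumes x: "square D x n t l r" and y: "square D y n b l r"
  shows "x \<oslash> a = y \<longleftrightarrow> x = y \<oslash> vinv D a"
proof -
  have i: "a \<oslash> vinv D a = IdH D t" "vinv D a \<oslash> a = IdH D b"
    using vinverse_of_vinv by (auto simp: vinverse_of_def globular_cells)
  have "(x \<oslash> a) \<oslash> vinv D a = x" "(y \<oslash> vinv D a) \<oslash> a = y"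
    using x y vinv_square by (simp_all add: square_def globular_cells i flip: vpaste_assoc_left)
  then show ?thesis by auto
qed

end

end

section \<open>Transfer of the axioms between mated data\<close>

locale companions_between =
  F: pseudo_double_functor A B F + G: pseudo_double_functor A B G
  for A :: "('o, 'h, 'v, 's) double_category"
    and B :: "('p, 'i, 'w, 't) double_category"
    and F G :: "('o, 'h, 'v, 's, 'p, 'i, 'w, 't) double_functor" +
  fixes u :: "'o \<Rightarrow> 'w" and c :: "'o \<Rightarrow> ('i, 't) companion_data"
  assumes comp: "X \<in> Obj A \<Longrightarrow> companion B (c X) (u X) (Fobj F X) (Fobj G X)"

context companions_between
begin

lemma hcell_objs: "hcell A f X Y \<Longrightarrow> X \<in> Obj A" "hcell A f X Y \<Longrightarrow> Y \<in> Obj A"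
  and vcell_objs: "vcell A v X Y \<Longrightarrow> X \<in> Obj A" "vcell A v X Y \<Longrightarrow> Y \<in> Obj A"
  by (auto simp: F.A.cell_iffs)

lemma image_cells:
  assumes "X \<in> Obj A"
  shows "hcell B (hid B (Fobj F X)) (Fobj F X) (Fobj F X)"
    "hcell B (hid B (Fobj G X)) (Fobj G X) (Fobj G X)"
    "vcell B (vid B (Fobj F X)) (Fobj F X) (Fobj F X)"
    "vcell B (vid B (Fobj G X)) (Fobj G X) (Fobj G X)"
  using assms by (auto intro: F.Fobj G.Fobj F.B.hid_hcell F.B.vid_vcell)

text \<open>
  At a 1h-cell both outer sides of the mate correspondence are identities. At a 1v-cell its top and
  bottom are, and the lower companion \<open>c Y\<close> comes first, since it is the one on the left side.
  Absorbing these identities gives the boundaries that occur in transformations.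
\<close>

lemma hor_mates:
  assumes f: "hcell A f X Y"
  defines "tb x \<equiv> square B x (c_hor (c Y) \<cdot>\<^bsub>B\<^esub> Fhor F f) (Fhor G f \<cdot>\<^bsub>B\<^esub> c_hor (c X))
      (vid B (Fobj F X)) (vid B (Fobj G Y))"
    and "lr a \<equiv> square B a (Fhor F f) (Fhor G f) (u X) (u Y)"
    and "m \<equiv> mate B (c X) (c Y) (vid B (Fobj F X)) (vid B (Fobj G Y))"
    and "m' \<equiv> unmate B (c X) (c Y) (Fhor F f) (Fhor G f)"
  shows "tb x \<Longrightarrow> lr (m' x)" "lr a \<Longrightarrow> tb (m a)" "tb x \<Longrightarrow> m (m' x) = x" "lr a \<Longrightarrow> m' (m a) = a"
proof -
  note X = hcell_objs[OF f]
  note cells = comp[OF X(1)] comp[OF X(2)] F.Fhor[OF f] G.Fhor[OF f]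
    image_cells(3)[OF X(1)] image_cells(4)[OF X(2)]
  have lr: "lr a \<longleftrightarrow> square B a (Fhor F f) (Fhor G f)
      (u X \<bullet>\<^bsub>B\<^esub> vid B (Fobj F X)) (vid B (Fobj G Y) \<bullet>\<^bsub>B\<^esub> u Y)" for a
    by (simp add: lr_def F.B.ver_simps cells[unfolded F.B.cell_iffs])
  show "tb x \<Longrightarrow> lr (m' x)" "lr a \<Longrightarrow> tb (m a)" "tb x \<Longrightarrow> m (m' x) = x" "lr a \<Longrightarrow> m' (m a) = a"
    unfolding lr unfolding tb_def m_def m'_def
    by (fact F.B.unmate_square[OF cells] F.B.mate_square[OF cells] F.B.mate_unmate[OF cells]
        F.B.unmate_mate[OF cells])+
qed

lemma ver_mates:
  assumes v: "vcell A v X Y"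
  defines "tb x \<equiv> square B x (c_hor (c X)) (c_hor (c Y)) (Fver F v) (Fver G v)"
    and "lr a \<equiv> square B a (hid B (Fobj F X)) (hid B (Fobj G Y))
      (u Y \<bullet>\<^bsub>B\<^esub> Fver F v) (Fver G v \<bullet>\<^bsub>B\<^esub> u X)"
    and "m \<equiv> mate B (c Y) (c X) (Fver F v) (Fver G v)"
    and "m' \<equiv> unmate B (c Y) (c X) (hid B (Fobj F X)) (hid B (Fobj G Y))"
  shows "tb x \<Longrightarrow> lr (m' x)" "lr a \<Longrightarrow> tb (m a)" "tb x \<Longrightarrow> m (m' x) = x" "lr a \<Longrightarrow> m' (m a) = a"
proof -
  note X = vcell_objs[OF v]
  note cells = comp[OF X(2)] comp[OF X(1)] image_cells(1)[OF X(1)] image_cells(2)[OF X(2)]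
    F.Fver[OF v] G.Fver[OF v]
  have tb: "tb x \<longleftrightarrow> square B x (c_hor (c X) \<cdot>\<^bsub>B\<^esub> hid B (Fobj F X))
      (hid B (Fobj G Y) \<cdot>\<^bsub>B\<^esub> c_hor (c Y)) (Fver F v) (Fver G v)" for x
    by (simp add: tb_def F.B.hor_simps cells[unfolded F.B.cell_iffs])
  show "tb x \<Longrightarrow> lr (m' x)" "lr a \<Longrightarrow> tb (m a)" "tb x \<Longrightarrow> m (m' x) = x" "lr a \<Longrightarrow> m' (m a) = a"
    unfolding tb unfolding lr_def m_def m'_def
    by (fact F.B.unmate_square[OF cells] F.B.mate_square[OF cells] F.B.mate_unmate[OF cells]
        F.B.unmate_mate[OF cells])+
qed

end

text \<open>
  The data of a vertical and of a horizontal transformation that are mates of each other, with the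
  boundary conditions but none of the equational axioms.
\<close>

locale mated_data = companions_between A B F G u c
  for A :: "('o, 'h, 'v, 's) double_category"
    and B :: "('p, 'i, 'w, 't) double_category"
    and F G :: "('o, 'h, 'v, 's, 'p, 'i, 'w, 't) double_functor"
    and u :: "'o \<Rightarrow> 'w" and c :: "'o \<Rightarrow> ('i, 't) companion_data" +
  fixes \<alpha> :: "('o, 'h, 'v, 'w, 't) vertical_data"
    and \<beta> :: "('o, 'h, 'v, 'i, 't) horizontal_data"
  assumes vt_ext: "vt_obj \<alpha> \<in> extensional (Obj A)" "vt_hor \<alpha> \<in> extensional (Hor A)"
      "vt_delta \<alpha> \<in> extensional (Ver A)"
    and ht_ext: "ht_obj \<beta> \<in> extensional (Obj A)" "ht_ver \<beta> \<in> extensional (Ver A)"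
      "ht_delta \<beta> \<in> extensional (Hor A)"
    and vt_obj: "X \<in> Obj A \<Longrightarrow> vt_obj \<alpha> X = u X"
    and ht_obj: "X \<in> Obj A \<Longrightarrow> ht_obj \<beta> X = c_hor (c X)"
    and ht_ver_square: "vcell A v X Y \<Longrightarrow>
      square B (ht_ver \<beta> v) (c_hor (c X)) (c_hor (c Y)) (Fver F v) (Fver G v)"
    and ht_delta_square: "hcell A f X Y \<Longrightarrow>
      square B (ht_delta \<beta> f) (c_hor (c Y) \<cdot>\<^bsub>B\<^esub> Fhor F f) (Fhor G f \<cdot>\<^bsub>B\<^esub> c_hor (c X))
        (vid B (Fobj F X)) (vid B (Fobj G Y))"
    and vt_hor: "hcell A f X Y \<Longrightarrow>
      vt_hor \<alpha> f = unmate B (c X) (c Y) (Fhor F f) (Fhor G f) (ht_delta \<beta> f)"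
    and vt_delta: "vcell A v X Y \<Longrightarrow>
      vt_delta \<alpha> v = unmate B (c Y) (c X) (hid B (Fobj F X)) (hid B (Fobj G Y)) (ht_ver \<beta> v)"
begin

lemma vt_hor_square:
  assumes f: "hcell A f X Y"
  shows "square B (vt_hor \<alpha> f) (Fhor F f) (Fhor G f) (u X) (u Y)"
  unfolding vt_hor[OF f] by (rule hor_mates(1)[OF f ht_delta_square[OF f]])

lemma vt_delta_square:
  assumes v: "vcell A v X Y"
  shows "square B (vt_delta \<alpha> v) (hid B (Fobj F X)) (hid B (Fobj G Y))
    (u Y \<bullet>\<^bsub>B\<^esub> Fver F v) (Fver G v \<bullet>\<^bsub>B\<^esub> u X)"
  unfolding vt_delta[OF v] by (rule ver_mates(1)[OF v ht_ver_square[OF v]])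

text \<open>
  Both sides of the horizontal axiom have the same boundary, and their mates are the two sides of
  the vertical axiom.
\<close>

lemma natural_iff:
  assumes a: "square A a f g v w"
  shows "(Fsqr F a \<parallel>\<^bsub>B\<^esub> ht_ver \<beta> w) \<oslash>\<^bsub>B\<^esub> ht_delta \<beta> g =
      ht_delta \<beta> f \<oslash>\<^bsub>B\<^esub> (ht_ver \<beta> v \<parallel>\<^bsub>B\<^esub> Fsqr G a) \<longleftrightarrow>
    (Fsqr F a \<oslash>\<^bsub>B\<^esub> vt_hor \<alpha> g) \<parallel>\<^bsub>B\<^esub> vt_delta \<alpha> w =
      vt_delta \<alpha> v \<parallel>\<^bsub>B\<^esub> (vt_hor \<alpha> f \<oslash>\<^bsub>B\<^esub> Fsqr G a)"
proof -
  obtain X Y X' Y' where f: "hcell A f X Y" and g: "hcell A g X' Y'"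
    and v: "vcell A v X X'" and w: "vcell A w Y Y'"
    using F.A.square_cells[OF a] by blast
  note X = hcell_objs[OF f] hcell_objs[OF g]
  note sq = F.Fsqr[OF a] G.Fsqr[OF a] ht_delta_square[OF f] ht_delta_square[OF g]
    ht_ver_square[OF v] ht_ver_square[OF w] vt_delta_square[OF w]
  note cells = F.Fhor[OF f] G.Fhor[OF f] F.Fhor[OF g] G.Fhor[OF g]
    F.Fver[OF v] G.Fver[OF v] F.Fver[OF w] G.Fver[OF w]
    comp[OF X(1)] comp[OF X(2)] comp[OF X(3)] comp[OF X(4)]
  note [simp] = F.B.boundary_simps cells[unfolded F.B.cell_iffs] sq[unfolded F.B.cell_iffs]
  let ?l = "(Fsqr F a \<parallel>\<^bsub>B\<^esub> ht_ver \<beta> w) \<oslash>\<^bsub>B\<^esub> ht_delta \<beta> g"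
  let ?r = "ht_delta \<beta> f \<oslash>\<^bsub>B\<^esub> (ht_ver \<beta> v \<parallel>\<^bsub>B\<^esub> Fsqr G a)"
  let ?U = "unmate B (c X') (c Y) (Fhor F f) (Fhor G g)"
  have "?U ?l = (Fsqr F a \<oslash>\<^bsub>B\<^esub> vt_hor \<alpha> g) \<parallel>\<^bsub>B\<^esub> (vt_delta \<alpha> w \<oslash>\<^bsub>B\<^esub> IdV B (vid B (Fobj G Y')))"
    unfolding vt_hor[OF g] vt_delta[OF w]
    by (rule F.B.unmate_paste_above)
      (rule cells sq image_cells X)+
  moreover have "?U ?r = vt_delta \<alpha> v \<parallel>\<^bsub>B\<^esub> (vt_hor \<alpha> f \<oslash>\<^bsub>B\<^esub> Fsqr G a)"
    unfolding vt_hor[OF f] vt_delta[OF v]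
    by (rule F.B.unmate_paste_below)
      (rule cells sq image_cells X)+
  moreover have "?U ?l = ?U ?r \<longleftrightarrow> ?l = ?r"
    by (rule F.B.unmate_eq_iff) ((rule cells)+, simp_all add: square_def)
  ultimately show ?thesis
    by simp
qed

text \<open>
  Pasting \<open>IdV (F v)\<close> onto the left of \<open>ht_ver \<beta> v\<close> does not change it, but exhibits the composite of
  \<open>ht_ver \<beta> v\<close> and \<open>ht_ver \<beta> w\<close> as a pasting as in \<open>unmate_paste_above\<close>.
\<close>

lemma vcomp_iff:
  assumes v: "vcell A v X Y" and w: "vcell A w Y Z"
  shows "ht_ver \<beta> (w \<bullet>\<^bsub>A\<^esub> v) = ht_ver \<beta> v \<oslash>\<^bsub>B\<^esub> ht_ver \<beta> w \<longleftrightarrow>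
    vt_delta \<alpha> (w \<bullet>\<^bsub>A\<^esub> v) =
      (IdV B (Fver F v) \<oslash>\<^bsub>B\<^esub> vt_delta \<alpha> w) \<parallel>\<^bsub>B\<^esub> (vt_delta \<alpha> v \<oslash>\<^bsub>B\<^esub> IdV B (Fver G w))"
proof -
  note wv = F.A.vcomp_vcell[OF v w]
  note X = vcell_objs[OF v] vcell_objs(2)[OF w]
  note sq = ht_ver_square[OF v] ht_ver_square[OF w] ht_ver_square[OF wv]
  note cells = F.Fver[OF v] G.Fver[OF v] F.Fver[OF w] G.Fver[OF w] F.Fver[OF wv] G.Fver[OF wv]
    comp[OF X(1)] comp[OF X(2)] comp[OF X(3)]
  note ids = image_cells[OF X(1)] image_cells[OF X(2)] image_cells[OF X(3)]
  note [simp] = F.B.boundary_simps cells[unfolded F.B.cell_iffs] sq[unfolded F.B.cell_iffs]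
    F.Fver_vcomp[OF v w] G.Fver_vcomp[OF v w]
  let ?r = "ht_ver \<beta> v \<oslash>\<^bsub>B\<^esub> ht_ver \<beta> w"
  let ?U = "unmate B (c Z) (c X) (hid B (Fobj F X)) (hid B (Fobj G Z))"
  have "?U ((IdV B (Fver F v) \<parallel>\<^bsub>B\<^esub> ht_ver \<beta> v) \<oslash>\<^bsub>B\<^esub> ht_ver \<beta> w) =
      (IdV B (Fver F v) \<oslash>\<^bsub>B\<^esub> vt_delta \<alpha> w) \<parallel>\<^bsub>B\<^esub> (vt_delta \<alpha> v \<oslash>\<^bsub>B\<^esub> IdV B (Fver G w))"
    unfolding vt_delta[OF v] vt_delta[OF w]
    by (rule F.B.unmate_paste_above)
      ((rule cells ids F.B.IdV_square)+, simp_all add: square_def)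
  moreover have "?U (ht_ver \<beta> (w \<bullet>\<^bsub>A\<^esub> v)) = ?U ?r \<longleftrightarrow> ht_ver \<beta> (w \<bullet>\<^bsub>A\<^esub> v) = ?r"
    by (rule F.B.unmate_eq_iff) ((rule cells ids)+, simp_all add: square_def)
  ultimately show ?thesis
    by (simp add: vt_delta[OF wv])
qed

lemma vid_iff:
  assumes X: "X \<in> Obj A"
  shows "ht_ver \<beta> (vid A X) = IdH B (ht_obj \<beta> X) \<longleftrightarrow> vt_delta \<alpha> (vid A X) = IdV B (vt_obj \<alpha> X)"
proof -
  note v = F.A.vid_vcell[OF X]
  note cells = comp[OF X] image_cells[OF X]
  note [simp] = F.B.boundary_simps cells[unfolded F.B.cell_iffs]
    ht_ver_square[OF v, unfolded F.B.cell_iffs] F.Fver_vid[OF X] G.Fver_vid[OF X]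
  let ?U = "unmate B (c X) (c X) (hid B (Fobj F X)) (hid B (Fobj G X))"
  have "?U (ht_ver \<beta> (vid A X)) = ?U (IdH B (c_hor (c X))) \<longleftrightarrow>
      ht_ver \<beta> (vid A X) = IdH B (c_hor (c X))"
    by (rule F.B.unmate_eq_iff) ((rule cells)+, simp_all add: square_def)
  then show ?thesis
    by (simp add: vt_delta[OF v] ht_obj[OF X] vt_obj[OF X] F.B.unmate_IdH[OF comp[OF X]])
qed

text \<open>
  The inner two rows of the horizontal axiom have mate \<open>vt_hor \<alpha> f \<parallel> vt_hor \<alpha> g\<close>, and the comparison
  squares in the outer two rows pass through to the mate. Inverting \<open>G\<^sub>g\<^sub>f\<close> then moves it to the
  other side of the vertical axiom.
\<close>

lemma hcomp_iff:
  assumes f: "hcell A f X Y" and g: "hcell A g Y Z"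
  shows "ht_delta \<beta> (g \<cdot>\<^bsub>A\<^esub> f) =
        (Fcomp F g f \<parallel>\<^bsub>B\<^esub> IdH B (ht_obj \<beta> Z))
        \<oslash>\<^bsub>B\<^esub> (IdH B (Fhor F f) \<parallel>\<^bsub>B\<^esub> ht_delta \<beta> g)
        \<oslash>\<^bsub>B\<^esub> (ht_delta \<beta> f \<parallel>\<^bsub>B\<^esub> IdH B (Fhor G g))
        \<oslash>\<^bsub>B\<^esub> (IdH B (ht_obj \<beta> X) \<parallel>\<^bsub>B\<^esub> vinv B (Fcomp G g f)) \<longleftrightarrow>
    Fcomp F g f \<oslash>\<^bsub>B\<^esub> (vt_hor \<alpha> f \<parallel>\<^bsub>B\<^esub> vt_hor \<alpha> g) = vt_hor \<alpha> (g \<cdot>\<^bsub>A\<^esub> f) \<oslash>\<^bsub>B\<^esub> Fcomp G g f"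
proof -
  note gf = F.A.hcomp_hcell[OF f g]
  note X = hcell_objs[OF f] hcell_objs(2)[OF g]
  note Fgf = F.Fcomp_square[OF f g] and Ggf = G.Fcomp_square[OF f g]
  note cells = F.Fhor[OF f] G.Fhor[OF f] F.Fhor[OF g] G.Fhor[OF g] F.Fhor[OF gf] G.Fhor[OF gf]
    F.B.hcomp_hcell[OF F.Fhor[OF f] F.Fhor[OF g]] F.B.hcomp_hcell[OF G.Fhor[OF f] G.Fhor[OF g]]
    comp[OF X(1)] comp[OF X(2)] comp[OF X(3)]
  note inv = G.Fcomp_vinvertible[OF f g] cells(6) cells(8) Ggf
  note Ginv = F.B.vinv_square[OF inv]
  note sq = ht_delta_square[OF f] ht_delta_square[OF g] ht_delta_square[OF gf] Fgf Ggf Ginv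
    vt_hor_square[OF f] vt_hor_square[OF g] vt_hor_square[OF gf]
  note ids = image_cells[OF X(1)] image_cells[OF X(2)] image_cells[OF X(3)]
  note [simp] = F.B.boundary_simps cells[unfolded F.B.cell_iffs] sq[unfolded F.B.cell_iffs]
  let ?d = "(IdH B (Fhor F f) \<parallel>\<^bsub>B\<^esub> ht_delta \<beta> g) \<oslash>\<^bsub>B\<^esub> (ht_delta \<beta> f \<parallel>\<^bsub>B\<^esub> IdH B (Fhor G g))"
  let ?r = "(Fcomp F g f \<parallel>\<^bsub>B\<^esub> IdH B (c_hor (c Z))) \<oslash>\<^bsub>B\<^esub> ?d
    \<oslash>\<^bsub>B\<^esub> (IdH B (c_hor (c X)) \<parallel>\<^bsub>B\<^esub> vinv B (Fcomp G g f))"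
  let ?U = "unmate B (c X) (c Z) (Fhor F (g \<cdot>\<^bsub>A\<^esub> f)) (Fhor G (g \<cdot>\<^bsub>A\<^esub> f))"
  have "?U ?r = Fcomp F g f \<oslash>\<^bsub>B\<^esub>
      unmate B (c X) (c Z) (Fhor F g \<cdot>\<^bsub>B\<^esub> Fhor F f) (Fhor G g \<cdot>\<^bsub>B\<^esub> Fhor G f) ?d \<oslash>\<^bsub>B\<^esub>
      vinv B (Fcomp G g f)"
    by (rule F.B.unmate_globular) ((rule cells ids sq)+, simp add: square_def)
  also have "unmate B (c X) (c Z) (Fhor F g \<cdot>\<^bsub>B\<^esub> Fhor F f) (Fhor G g \<cdot>\<^bsub>B\<^esub> Fhor G f) ?d =
      vt_hor \<alpha> f \<parallel>\<^bsub>B\<^esub> vt_hor \<alpha> g"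
    unfolding vt_hor[OF f] vt_hor[OF g] by (rule F.B.unmate_hcomp) (rule cells sq)+
  finally have U: "?U ?r = Fcomp F g f \<oslash>\<^bsub>B\<^esub> (vt_hor \<alpha> f \<parallel>\<^bsub>B\<^esub> vt_hor \<alpha> g) \<oslash>\<^bsub>B\<^esub> vinv B (Fcomp G g f)" .
  have "ht_delta \<beta> (g \<cdot>\<^bsub>A\<^esub> f) = ?r \<longleftrightarrow> ?U (ht_delta \<beta> (g \<cdot>\<^bsub>A\<^esub> f)) = ?U ?r"
    by (rule F.B.unmate_eq_iff[symmetric]) ((rule cells ids)+, simp_all add: square_def)
  also have "\<dots> \<longleftrightarrow> vt_hor \<alpha> (g \<cdot>\<^bsub>A\<^esub> f) =
      Fcomp F g f \<oslash>\<^bsub>B\<^esub> (vt_hor \<alpha> f \<parallel>\<^bsub>B\<^esub> vt_hor \<alpha> g) \<oslash>\<^bsub>B\<^esub> vinv B (Fcomp G g f)"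
    unfolding U vt_hor[OF gf] ..
  also have "\<dots> \<longleftrightarrow> vt_hor \<alpha> (g \<cdot>\<^bsub>A\<^esub> f) \<oslash>\<^bsub>B\<^esub> Fcomp G g f =
      Fcomp F g f \<oslash>\<^bsub>B\<^esub> (vt_hor \<alpha> f \<parallel>\<^bsub>B\<^esub> vt_hor \<alpha> g)"
    by (rule F.B.vpaste_right_eq_iff[OF inv, symmetric]) (rule sq, simp add: square_def)
  finally show ?thesis
    by (auto simp: ht_obj[OF X(1)] ht_obj[OF X(3)] F.B.vpaste_assoc_left)
qed

text \<open>The same with \<open>F\<^sub>X\<close> moved across and the mate \<open>IdV (u X)\<close> of the identity on \<open>c_hor (c X)\<close>.\<close>

lemma hid_iff:
  assumes X: "X \<in> Obj A"
  shows "(vinv B (Funit F X) \<parallel>\<^bsub>B\<^esub> IdH B (ht_obj \<beta> X))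
        \<oslash>\<^bsub>B\<^esub> ht_delta \<beta> (hid A X)
        \<oslash>\<^bsub>B\<^esub> (IdH B (ht_obj \<beta> X) \<parallel>\<^bsub>B\<^esub> Funit G X)
      = IdH B (ht_obj \<beta> X) \<longleftrightarrow>
    Funit F X \<oslash>\<^bsub>B\<^esub> IdV B (vt_obj \<alpha> X) = vt_hor \<alpha> (hid A X) \<oslash>\<^bsub>B\<^esub> Funit G X"
proof -
  note i = F.A.hid_hcell[OF X]
  note FX = F.Funit_square[OF X] and GX = G.Funit_square[OF X]
  note cells = F.Fhor[OF i] G.Fhor[OF i] comp[OF X] image_cells[OF X]
  note inv = F.Funit_vinvertible[OF X] cells(1) cells(4) FX
  note Finv = F.B.vinv_square[OF inv]
  note sq = ht_delta_square[OF i] FX GX Finv vt_hor_square[OF i]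
  note [simp] = F.B.boundary_simps cells[unfolded F.B.cell_iffs] sq[unfolded F.B.cell_iffs]
  let ?l = "(vinv B (Funit F X) \<parallel>\<^bsub>B\<^esub> IdH B (c_hor (c X))) \<oslash>\<^bsub>B\<^esub> ht_delta \<beta> (hid A X)
    \<oslash>\<^bsub>B\<^esub> (IdH B (c_hor (c X)) \<parallel>\<^bsub>B\<^esub> Funit G X)"
  let ?U = "unmate B (c X) (c X) (hid B (Fobj F X)) (hid B (Fobj G X))"
  have U: "?U ?l = vinv B (Funit F X) \<oslash>\<^bsub>B\<^esub> vt_hor \<alpha> (hid A X) \<oslash>\<^bsub>B\<^esub> Funit G X"
    unfolding vt_hor[OF i] by (rule F.B.unmate_globular) (rule cells sq)+
  have "?l = IdH B (c_hor (c X)) \<longleftrightarrow> ?U ?l = ?U (IdH B (c_hor (c X)))"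
    by (rule F.B.unmate_eq_iff[symmetric]) ((rule cells)+, simp_all add: square_def)
  also have "\<dots> \<longleftrightarrow> IdV B (u X) = vinv B (Funit F X) \<oslash>\<^bsub>B\<^esub> (vt_hor \<alpha> (hid A X) \<oslash>\<^bsub>B\<^esub> Funit G X)"
    unfolding U F.B.unmate_IdH[OF comp[OF X]] by (auto simp: F.B.vpaste_assoc_left)
  also have "\<dots> \<longleftrightarrow> Funit F X \<oslash>\<^bsub>B\<^esub> IdV B (u X) = vt_hor \<alpha> (hid A X) \<oslash>\<^bsub>B\<^esub> Funit G X"
    by (rule F.B.vpaste_left_eq_iff[OF inv, symmetric]) (simp_all add: square_def)
  finally show ?thesis
    by (simp add: ht_obj[OF X] vt_obj[OF X])
qed

lemma strong_transformation_iff: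
  "strong_horizontal_transformation A B F G \<beta> \<longleftrightarrow> strong_vertical_transformation A B F G \<alpha>"
proof
  assume "strong_horizontal_transformation A B F G \<beta>"
  then interpret strong_horizontal_transformation A B F G \<beta> .
  show "strong_vertical_transformation A B F G \<alpha>"
  proof
    show "vcell B (vt_obj \<alpha> X) (Fobj F X) (Fobj G X)" if "X \<in> Obj A" for X
      using comp[OF that] by (simp add: vt_obj[OF that] companion_def)
  next
    show "square B (vt_hor \<alpha> f) (Fhor F f) (Fhor G f) (vt_obj \<alpha> X) (vt_obj \<alpha> Y)"
      if "hcell A f X Y" for f X Y
      using vt_hor_square[OF that] hcell_objs[OF that] by (simp add: vt_obj)
  next
    show "square B (vt_delta \<alpha> v) (hid B (Fobj F X)) (hid B (Fobj G Y))
        (vt_obj \<alpha> Y \<bullet>\<^bsub>B\<^esub> Fver F v) (Fver G v \<bullet>\<^bsub>B\<^esub> vt_obj \<alpha> X)"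
      if "vcell A v X Y" for v X Y
      using vt_delta_square[OF that] vcell_objs[OF that] by (simp add: vt_obj)
  qed (fact vt_ext | rule natural_iff[THEN iffD1] hcomp_iff[THEN iffD1] hid_iff[THEN iffD1]
      vcomp_iff[THEN iffD1] vid_iff[THEN iffD1], assumption+,
      rule natural delta_hcomp delta_hid ver_vcomp ver_vid, assumption+)+
next
  assume "strong_vertical_transformation A B F G \<alpha>"
  then interpret strong_vertical_transformation A B F G \<alpha> .
  show "strong_horizontal_transformation A B F G \<beta>"
  proof
    show "hcell B (ht_obj \<beta> X) (Fobj F X) (Fobj G X)" if "X \<in> Obj A" for X
      using comp[OF that] by (simp add: ht_obj[OF that] F.B.cell_iffs)
  next
    show "square B (ht_ver \<beta> v) (ht_obj \<beta> X) (ht_obj \<beta> Y) (Fver F v) (Fver G v)"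
      if "vcell A v X Y" for v X Y
      using ht_ver_square[OF that] vcell_objs[OF that] by (simp add: ht_obj)
  next
    show "square B (ht_delta \<beta> f) (ht_obj \<beta> Y \<cdot>\<^bsub>B\<^esub> Fhor F f) (Fhor G f \<cdot>\<^bsub>B\<^esub> ht_obj \<beta> X)
        (vid B (Fobj F X)) (vid B (Fobj G Y))"
      if "hcell A f X Y" for f X Y
      using ht_delta_square[OF that] hcell_objs[OF that] by (simp add: ht_obj)
  qed (fact ht_ext | rule natural_iff[THEN iffD2] hcomp_iff[THEN iffD2] hid_iff[THEN iffD2]
      vcomp_iff[THEN iffD2] vid_iff[THEN iffD2], assumption+,
      rule natural hor_hcomp hor_hid delta_vcomp delta_vid, assumption+)+
qed

end

section \<open>The mate of a transformation\<close>

definition horizontal_mate ::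
  "('o, 'h, 'v, 's) double_category \<Rightarrow> ('p, 'i, 'w, 't) double_category \<Rightarrow>
   ('o, 'h, 'v, 's, 'p, 'i, 'w, 't) double_functor \<Rightarrow>
   ('o, 'h, 'v, 's, 'p, 'i, 'w, 't) double_functor \<Rightarrow>
   ('o \<Rightarrow> ('i, 't) companion_data) \<Rightarrow>
   ('o, 'h, 'v, 'w, 't) vertical_data \<Rightarrow> ('o, 'h, 'v, 'i, 't) horizontal_data" where
  "horizontal_mate A B F G c \<alpha> =
     \<lparr>ht_obj = restrict (\<lambda>X. c_hor (c X)) (Obj A),
      ht_ver = restrict (\<lambda>v. mate B (c (vcod A v)) (c (vdom A v)) (Fver F v) (Fver G v)
        (vt_delta \<alpha> v)) (Ver A),
      ht_delta = restrict (\<lambda>f. mate B (c (hdom A f)) (c (hcod A f))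
        (vid B (Fobj F (hdom A f))) (vid B (Fobj G (hcod A f))) (vt_hor \<alpha> f)) (Hor A)\<rparr>"

definition vertical_mate ::
  "('o, 'h, 'v, 's) double_category \<Rightarrow> ('p, 'i, 'w, 't) double_category \<Rightarrow>
   ('o, 'h, 'v, 's, 'p, 'i, 'w, 't) double_functor \<Rightarrow>
   ('o, 'h, 'v, 's, 'p, 'i, 'w, 't) double_functor \<Rightarrow>
   ('o \<Rightarrow> 'w) \<Rightarrow> ('o \<Rightarrow> ('i, 't) companion_data) \<Rightarrow>
   ('o, 'h, 'v, 'i, 't) horizontal_data \<Rightarrow> ('o, 'h, 'v, 'w, 't) vertical_data" where
  "vertical_mate A B F G u c \<beta> =
     \<lparr>vt_obj = restrict u (Obj A),
      vt_hor = restrict (\<lambda>f. unmate B (c (hdom A f)) (c (hcod A f))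
        (Fhor F f) (Fhor G f) (ht_delta \<beta> f)) (Hor A),
      vt_delta = restrict (\<lambda>v. unmate B (c (vcod A v)) (c (vdom A v))
        (hid B (Fobj F (vdom A v))) (hid B (Fobj G (vcod A v))) (ht_ver \<beta> v)) (Ver A)\<rparr>"

context companions_between
begin

lemma mated_data_horizontal_mate:
  assumes \<alpha>: "strong_vertical_transformation A B F G \<alpha>"
    and u: "\<And>X. X \<in> Obj A \<Longrightarrow> vt_obj \<alpha> X = u X"
  shows "mated_data A B F G u c \<alpha> (horizontal_mate A B F G c \<alpha>)"
proof -
  interpret strong_vertical_transformation A B F G \<alpha> by fact
  have hor: "square B (vt_hor \<alpha> f) (Fhor F f) (Fhor G f) (u X) (u Y)" if "hcell A f X Y" for f X Y
    using hor_square[OF that] hcell_objs[OF that] by (simp add: u)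
  have delta: "square B (vt_delta \<alpha> v) (hid B (Fobj F X)) (hid B (Fobj G Y))
      (u Y \<bullet>\<^bsub>B\<^esub> Fver F v) (Fver G v \<bullet>\<^bsub>B\<^esub> u X)" if "vcell A v X Y" for v X Y
    using delta_square[OF that] vcell_objs[OF that] by (simp add: u)
  let ?\<beta> = "horizontal_mate A B F G c \<alpha>"
  have ver_eq: "ht_ver ?\<beta> v = mate B (c Y) (c X) (Fver F v) (Fver G v) (vt_delta \<alpha> v)"
    if "vcell A v X Y" for v X Y
    using that by (auto simp: horizontal_mate_def vcell_def)
  have delta_eq: "ht_delta ?\<beta> f = mate B (c X) (c Y) (vid B (Fobj F X)) (vid B (Fobj G Y)) (vt_hor \<alpha> f)"
    if "hcell A f X Y" for f X Y
    using that by (auto simp: horizontal_mate_def hcell_def)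
  show ?thesis
  proof (intro mated_data.intro mated_data_axioms.intro)
    show "companions_between A B F G u c" by unfold_locales
  qed (simp_all add: ext u ver_eq delta_eq hor_mates hor ver_mates delta,
      simp_all add: horizontal_mate_def)
qed

lemma mated_data_vertical_mate:
  assumes \<beta>: "strong_horizontal_transformation A B F G \<beta>"
    and obj: "\<And>X. X \<in> Obj A \<Longrightarrow> ht_obj \<beta> X = c_hor (c X)"
  shows "mated_data A B F G u c (vertical_mate A B F G u c \<beta>) \<beta>"
proof -
  interpret strong_horizontal_transformation A B F G \<beta> by fact
  have ver: "square B (ht_ver \<beta> v) (c_hor (c X)) (c_hor (c Y)) (Fver F v) (Fver G v)"
    if "vcell A v X Y" for v X Y
    using ver_square[OF that] vcell_objs[OF that] by (simp add: obj)
  have delta: "square B (ht_delta \<beta> f) (c_hor (c Y) \<cdot>\<^bsub>B\<^esub> Fhor F f) (Fhor G f \<cdot>\<^bsub>B\<^esub> c_hor (c X))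
      (vid B (Fobj F X)) (vid B (Fobj G Y))" if "hcell A f X Y" for f X Y
    using delta_square[OF that] hcell_objs[OF that] by (simp add: obj)
  show ?thesis
  proof (intro mated_data.intro mated_data_axioms.intro)
    show "companions_between A B F G u c" by unfold_locales
  qed (auto simp: ext obj ver delta vertical_mate_def hcell_def vcell_def)
qed

end

context mated_data
begin

lemma vertical_mate_eq: "vertical_mate A B F G u c \<beta> = \<alpha>"
  unfolding vertical_mate_def
  by (rule vertical_data.equality)
    (auto intro!: extensionalityI[OF restrict_extensional] simp: vt_ext vt_obj vt_hor vt_delta
      hcell_def vcell_def)

lemma horizontal_mate_eq: "horizontal_mate A B F G c \<alpha> = \<beta>"
proof -
  have "mate B (c (vcod A v)) (c (vdom A v)) (Fver F v) (Fver G v) (vt_delta \<alpha> v) = ht_ver \<beta> v"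
    if "v \<in> Ver A" for v
  proof -
    have v: "vcell A v (vdom A v) (vcod A v)" using that by (simp add: vcell_def)
    show ?thesis unfolding vt_delta[OF v] by (rule ver_mates(3)[OF v ht_ver_square[OF v]])
  qed
  moreover have "mate B (c (hdom A f)) (c (hcod A f)) (vid B (Fobj F (hdom A f)))
      (vid B (Fobj G (hcod A f))) (vt_hor \<alpha> f) = ht_delta \<beta> f" if "f \<in> Hor A" for f
  proof -
    have f: "hcell A f (hdom A f) (hcod A f)" using that by (simp add: hcell_def)
    show ?thesis unfolding vt_hor[OF f] by (rule hor_mates(3)[OF f ht_delta_square[OF f]])
  qed
  ultimately show ?thesis
    unfolding horizontal_mate_def
    by (intro horizontal_data.equality)
      (auto intro!: extensionalityI[OF restrict_extensional] simp: ht_ext ht_obj)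
qed

end

text \<open>
  In both directions mates are formed along the companions \<open>\<Gamma> (u X)\<close>. The connection supplies these
  when \<open>u\<close> consists of the components of a vertical transformation; on the horizontal side they are
  part of what it means for \<open>u\<close> to accompany the transformation.
\<close>

theorem corollary4p3:
  fixes A :: "('o, 'h, 'v, 's) double_category"
    and B :: "('p, 'i, 'w, 't) double_category"
    and F G :: "('o, 'h, 'v, 's, 'p, 'i, 'w, 't) double_functor"
    and \<Gamma> :: "'w \<Rightarrow> ('i, 't) companion_data"
  assumes "strict_double_category A" and "strict_double_category B"
    and "pseudo_double_functor A B F" and "pseudo_double_functor A B G"
    and "connection_on B (vertical_components A B F G) \<Gamma>"
  shows "\<exists>\<Phi>. bij_betw \<Phi> {\<alpha>. strong_vertical_transformation A B F G \<alpha>}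
             (companion_horizontal_transformations A B F G \<Gamma>) \<and>
           (\<forall>\<alpha>. strong_vertical_transformation A B F G \<alpha> \<longrightarrow> snd (\<Phi> \<alpha>) = vt_obj \<alpha>)"
proof -
  interpret F: pseudo_double_functor A B F by fact
  interpret G: pseudo_double_functor A B G by fact
  define \<Phi> where "\<Phi> = (\<lambda>\<alpha>. (horizontal_mate A B F G (\<lambda>X. \<Gamma> (vt_obj \<alpha> X)) \<alpha>, vt_obj \<alpha>))"
  define \<Psi> where "\<Psi> = (\<lambda>(\<beta>, u). vertical_mate A B F G u (\<lambda>X. \<Gamma> (u X)) \<beta>)"
  have vertical: "\<Psi> (\<Phi> \<alpha>) = \<alpha> \<and> \<Phi> \<alpha> \<in> companion_horizontal_transformations A B F G \<Gamma>"
    if \<alpha>: "strong_vertical_transformation A B F G \<alpha>" for \<alpha>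
  proof -
    interpret strong_vertical_transformation A B F G \<alpha> by fact
    have chosen: "is_companion B (vt_obj \<alpha> X) (\<Gamma> (vt_obj \<alpha> X))" if "X \<in> Obj A" for X
      using assms(5) \<alpha> that unfolding connection_on_def vertical_components_def by blast
    interpret companions_between A B F G "vt_obj \<alpha>" "\<lambda>X. \<Gamma> (vt_obj \<alpha> X)"
      by unfold_locales (simp add: companion_def chosen obj_vcell)
    interpret mated_data A B F G "vt_obj \<alpha>" "\<lambda>X. \<Gamma> (vt_obj \<alpha> X)" \<alpha>
      "horizontal_mate A B F G (\<lambda>X. \<Gamma> (vt_obj \<alpha> X)) \<alpha>"
      using \<alpha> by (rule mated_data_horizontal_mate) simp
    show ?thesis
      using \<alpha> ext(1) vertical_mate_eq strong_transformation_iff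
      by (simp add: \<Phi>_def \<Psi>_def companion_horizontal_transformations_def obj_vcell chosen ht_obj)
  qed
  have horizontal: "\<Phi> (\<Psi> (\<beta>, u)) = (\<beta>, u) \<and> strong_vertical_transformation A B F G (\<Psi> (\<beta>, u))"
    if \<beta>u: "(\<beta>, u) \<in> companion_horizontal_transformations A B F G \<Gamma>" for \<beta> u
  proof -
    have \<beta>: "strong_horizontal_transformation A B F G \<beta>" and u: "u \<in> extensional (Obj A)"
      and obj: "\<And>X. X \<in> Obj A \<Longrightarrow> vcell B (u X) (Fobj F X) (Fobj G X) \<and>
        is_companion B (u X) (\<Gamma> (u X)) \<and> ht_obj \<beta> X = c_hor (\<Gamma> (u X))"
      using \<beta>u unfolding companion_horizontal_transformations_def by auto
    interpret companions_between A B F G u "\<lambda>X. \<Gamma> (u X)"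
      by unfold_locales (simp add: companion_def obj)
    interpret mated_data A B F G u "\<lambda>X. \<Gamma> (u X)" "\<Psi> (\<beta>, u)" \<beta>
      unfolding \<Psi>_def prod.case using \<beta> by (rule mated_data_vertical_mate) (simp add: obj)
    have "vt_obj (\<Psi> (\<beta>, u)) = u"
      by (rule extensionalityI[OF vt_ext(1) u vt_obj])
    then show ?thesis
      using \<beta> strong_transformation_iff horizontal_mate_eq by (simp add: \<Phi>_def)
  qed
  have "bij_betw \<Phi> {\<alpha>. strong_vertical_transformation A B F G \<alpha>}
      (companion_horizontal_transformations A B F G \<Gamma>)"
    by (rule bij_betw_byWitness[where f'=\<Psi>]) (use vertical horizontal in auto)
  then show ?thesis
    by (intro exI[of _ \<Phi>]) (simp add: \<Phi>_def)
qed

end
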